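(* Let $p$ be a prime number and let $K$ be a multi-EGS-group acting on the $p$-adic rooted tree. Then for every $n\ge 1$ $$\exp(K_n)=\begin{cases} p^{\lfloor \frac{n+1}{2}\rfloor} & \text{if } K \text{ is periodic},\\ p^n & \text{otherwise,}\end{cases}$$ where $\lfloor \frac{n+1}{2}\rfloor$ is the greatest integer less than or equal to $\frac{n+1}{2}$.
   Context: Let $p$ be a prime and $X=\{1,\dots,p\}$. The $p$-adic rooted tree $\mathcal{T}$ has as vertices the finite words in the alphabet $X$ (including the empty word $\emptyset$, the root), the children of a word $u$ being the words $ux$, $x\in X$. $\mathrm{Aut}\,\mathcal{T}$ is its group of (rooted tree) automorphisms; $fg$ denotes first $f$ and then $g$, i.e. $(fg)(u)=g(f(u))$, and $x^y=y^{-1}xy$. $\mathrm{St}(n)$ is the subgroup of automorphisms fixing all words of length $n$. For $G\le \mathrm{Aut}\,\mathcal{T}$ put $\mathrm{St}_G(n)=\mathrm{St}(n)\cap G$ and $G_n=G/\mathrm{St}_G(n)$, the $n$th congruence quotient of $G$ (a finite group); $\exp$ denotes the exponent of a group. For $g\in\mathrm{Aut}\,\mathcal{T}$ and a vertex $u$, the section $g_u\in\mathrm{Aut}\,\mathcal{T}$ is defined by $g(uv)=g(u)g_u(v)$ for all words $v$. The map $\psi:\mathrm{St}(1)\to \mathrm{Aut}\,\mathcal{T}\times\overset{p}{\cdots}\times\mathrm{Aut}\,\mathcal{T}$, $g\mapsto(g_1,\dots,g_p)$, is a group isomorphism. Let $a\in\mathrm{Aut}\,\mathcal{T}$ be the automorphism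 with $a(xw)=\sigma(x)w$ for $x\in X$ and every word $w$, where $\sigma=(1\,2\,\cdots\,p)$; it has order $p$, so $a^e$ makes sense for $e\in\mathbb{F}_p$. For $\mathbf{e}=(e_1,\dots,e_{p-1})\in(\mathbb{F}_p)^{p-1}$ and $j\in X$, the directed automorphism along the path $P_j=(\emptyset,j,jj,\dots)$ with defining vector $\mathbf{e}$ is the unique $b\in\mathrm{St}(1)$ defined recursively by $$\psi(b)=(a^{e_{p-j+1}},\dots,a^{e_{p-1}},b,a^{e_1},\dots,a^{e_{p-j}})$$ (with $b$ in position $j$). Let $E^{(1)},\dots,E^{(p)}$ be vector subspaces of $(\mathbb{F}_p)^{p-1}$, not all equal to the null subspace, and for each $j$ let $B^{(j)}$ be the set of all directed automorphisms along $P_j$ with defining vector in $E^{(j)}$. The group $K=\langle a,B^{(1)},\dots,B^{(p)}\rangle$ is the multi-EGS-group associated to $(E^{(1)},\dots,E^{(p)})$. A group is periodic if all its elements have finite order. *)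

theory Defs
  imports "HOL-Algebra.Algebra" "HOL-Number_Theory.Residues"
begin

section \<open>The rooted tree and its automorphisms\<close>

definition alphabet :: "nat \<Rightarrow> nat set"
  where "alphabet p = {1..p}"

abbreviation words :: "nat \<Rightarrow> nat list set"
  where "words p \<equiv> lists (alphabet p)"

definition child_of :: "nat \<Rightarrow> nat list \<Rightarrow> nat list \<Rightarrow> bool"
  where "child_of p v u \<longleftrightarrow> (\<exists>x\<in>alphabet p. v = u @ [x])"

text \<open>Automorphisms are extensional on the set of words, so that equality of functions is
  equality of automorphisms. The product of \<open>f\<close> and \<open>g\<close> is first \<open>f\<close>, then \<open>g\<close>, which is the
  opposite of the convention of \<open>BijGroup\<close>.\<close>

definition Aut_tree :: "nat \<Rightarrow> (nat list \<Rightarrow> nat list) monoid"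
  where "Aut_tree p =
    \<lparr>carrier = {f \<in> extensional (words p). bij_betw f (words p) (words p) \<and> f [] = [] \<and>
        (\<forall>u\<in>words p. \<forall>v\<in>words p. child_of p v u \<longleftrightarrow> child_of p (f v) (f u))},
     monoid.mult = (\<lambda>f g. compose (words p) g f),
     one = (\<lambda>w\<in>words p. w)\<rparr>"

definition level_stabilizer :: "nat \<Rightarrow> nat \<Rightarrow> (nat list \<Rightarrow> nat list) set"
  where "level_stabilizer p n =
    {g \<in> carrier (Aut_tree p). \<forall>w\<in>words p. length w = n \<longrightarrow> g w = w}"

text \<open>Automorphisms preserve the length and the prefixes of words, so dropping the first
  \<open>length u\<close> letters of \<open>g (u @ v)\<close> yields the word \<open>g\<^sub>u(v)\<close> with
  \<open>g (u @ v) = g u @ g\<^sub>u(v)\<close>.\<close>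

definition tree_section ::
  "nat \<Rightarrow> (nat list \<Rightarrow> nat list) \<Rightarrow> nat list \<Rightarrow> nat list \<Rightarrow> nat list"
  where "tree_section p g u = (\<lambda>v\<in>words p. drop (length u) (g (u @ v)))"

definition psi :: "nat \<Rightarrow> (nat list \<Rightarrow> nat list) \<Rightarrow> (nat list \<Rightarrow> nat list) list"
  where "psi p g = map (\<lambda>x. tree_section p g [x]) [1..<p + 1]"

section \<open>Multi-EGS-groups\<close>

definition sigma :: "nat \<Rightarrow> nat \<Rightarrow> nat"
  where "sigma p x = (if x = p then 1 else x + 1)"

definition rooted_aut :: "nat \<Rightarrow> nat list \<Rightarrow> nat list"
  where "rooted_aut p = (\<lambda>w\<in>words p. case w of [] \<Rightarrow> [] | x # v \<Rightarrow> sigma p x # v)"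

text \<open>The module of vectors \<open>(e\<^sub>1, \<dots>, e\<^bsub>p-1\<^esub>)\<close> over \<open>residue_ring p\<close>; its submodules are the vector
  subspaces. The fields \<open>mult\<close> and \<open>one\<close> of the record play no role in a module.\<close>

definition Fp_vectors :: "nat \<Rightarrow> (int, nat \<Rightarrow> int) module"
  where "Fp_vectors p =
    \<lparr>carrier = {1..<p} \<rightarrow>\<^sub>E carrier (residue_ring (int p)),
     monoid.mult = undefined,
     monoid.one = undefined,
     ring.zero = (\<lambda>i\<in>{1..<p}. \<zero>\<^bsub>residue_ring (int p)\<^esub>),
     ring.add = (\<lambda>u v. \<lambda>i\<in>{1..<p}. u i \<oplus>\<^bsub>residue_ring (int p)\<^esub> v i),
     module.smult = (\<lambda>c v. \<lambda>i\<in>{1..<p}. c \<otimes>\<^bsub>residue_ring (int p)\<^esub> v i)\<rparr>"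

definition directed_along ::
  "nat \<Rightarrow> nat \<Rightarrow> (nat \<Rightarrow> int) \<Rightarrow> (nat list \<Rightarrow> nat list) \<Rightarrow> bool"
  where "directed_along p j e b \<longleftrightarrow>
    b \<in> level_stabilizer p 1 \<and>
    psi p b =
      map (\<lambda>i. rooted_aut p [^]\<^bsub>Aut_tree p\<^esub> e i) [p - j + 1..<p]
      @ [b]
      @ map (\<lambda>i. rooted_aut p [^]\<^bsub>Aut_tree p\<^esub> e i) [1..<p - j + 1]"

definition directed_family ::
  "nat \<Rightarrow> nat \<Rightarrow> (nat \<Rightarrow> int) set \<Rightarrow> (nat list \<Rightarrow> nat list) set"
  where "directed_family p j V = {b. \<exists>e\<in>V. directed_along p j e b}"

definition multi_EGS_group ::
  "nat \<Rightarrow> (nat \<Rightarrow> (nat \<Rightarrow> int) set) \<Rightarrow> (nat list \<Rightarrow> nat list) set"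
  where "multi_EGS_group p E =
    generate (Aut_tree p) (insert (rooted_aut p) (\<Union>j\<in>{1..p}. directed_family p j (E j)))"

definition is_multi_EGS_group :: "nat \<Rightarrow> (nat list \<Rightarrow> nat list) set \<Rightarrow> bool"
  where "is_multi_EGS_group p K \<longleftrightarrow>
    (\<exists>E. (\<forall>j\<in>{1..p}. submodule (E j) (residue_ring (int p)) (Fp_vectors p)) \<and>
         (\<exists>j\<in>{1..p}. E j \<noteq> {\<zero>\<^bsub>Fp_vectors p\<^esub>}) \<and>
         K = multi_EGS_group p E)"

section \<open>Congruence quotients, exponent, periodicity\<close>

definition congruence_quotient ::
  "nat \<Rightarrow> (nat list \<Rightarrow> nat list) set \<Rightarrow> nat \<Rightarrow> (nat list \<Rightarrow> nat list) set monoid"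
  where "congruence_quotient p K n =
    (Aut_tree p)\<lparr>carrier := K\<rparr> Mod (level_stabilizer p n \<inter> K)"

definition group_exponent :: "('a, 'b) monoid_scheme \<Rightarrow> nat"
  where "group_exponent G =
    (LEAST m. 0 < m \<and> (\<forall>x\<in>carrier G. x [^]\<^bsub>G\<^esub> m = \<one>\<^bsub>G\<^esub>))"

definition periodic_group :: "('a, 'b) monoid_scheme \<Rightarrow> bool"
  where "periodic_group G \<longleftrightarrow> (\<forall>x\<in>carrier G. \<exists>m::nat. 0 < m \<and> x [^]\<^bsub>G\<^esub> m = \<one>\<^bsub>G\<^esub>)"

end

theory Submission
  imports Defs
begin

text \<open>
  Every automorphism \<open>g\<close> in a multi-EGS-group \<open>K\<close> permutes the letters by a power of the
  \<open>p\<close>-cycle \<open>\<sigma>\<close>, say \<open>\<sigma>\<^sup>r\<close>, and its sections lie in \<open>K\<close> again. If \<open>r\<close> is divisible by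
  \<open>p\<close> then powers of \<open>g\<close> are computed section by section. Otherwise each section of
  \<open>g\<^sup>p\<close> is the product of all the sections of \<open>g\<close>, read along the cycle. Since \<open>p\<close>-th powers fix
  the first level, the \<open>p\<^sup>n\<close>-th power of every element fixes level \<open>n\<close>; in particular the
  exponent of \<open>K\<^sub>n\<close> is a power of \<open>p\<close> (\<open>pow_fixes_level\<close>). Two cases arise from
  the sums of the entries of the defining vectors.

  If some generator \<open>b\<close> has a defining vector with nonzero sum \<open>\<epsilon>\<close>, then for \<open>c \<noteq> 0\<close>
  one section of \<open>(b a\<^sup>c)\<^sup>p\<close> is \<open>b a\<^sup>\<epsilon>\<close>, an element of the same shape. By induction \<open>b a\<^sup>c\<close> has
  order \<open>p\<^sup>n\<close> on the first \<open>n\<close> levels, so \<open>K\<close> is not periodic and \<open>exp(K\<^sub>n) = p\<^sup>n\<close>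
  (\<open>pow_not_fixes_level\<close>).

  If all the sums vanish, then the rotations of the sections of any element of \<open>K\<close> add up to
  \<open>0\<close>. Hence, for an element that moves the first level, the sections of its \<open>p\<close>-th power fix
  the first level: raising to the power \<open>p\<close> pays for two levels, which gives the upper bound
  (\<open>pow_half_fixes_level\<close>). Periodicity is an induction on the number of directed generators
  in a word: in the sections of an element that fixes the first level this number is smaller, or the
  section is a product of directed generators alone, and such a product has order \<open>p\<close> or all its
  sections involve fewer of them (\<open>periodic\<close>).

  For the lower bound in that case it suffices to use one directed generator \<open>b\<close> with a nonzero
  vector, and the group \<open>G = \<langle>a, b\<rangle>\<close>. Given \<open>x \<in> G\<close> that moves the first level, an element \<open>y\<close>
  of the same kind is constructed such that \<open>x\<close> is a section of a section \<open>h\<close> of \<open>y\<^sup>p\<close>, where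
  \<open>h\<close> fixes the first level; then \<open>y\<close> gains a factor \<open>p\<close> in its order two levels further down
  (\<open>ex_double_section_of_pow_p\<close>). Finding \<open>h\<close> with section \<open>x\<close> is easy, and its exponent
  sum in \<open>b\<close> can be made nonzero. The sections of \<open>p\<close>-th powers are less flexible: the obvious
  candidate \<open>y = b\<^sup>s a\<close> has \<open>b\<^sup>s\<close> as a section of \<open>y\<^sup>p\<close>. What closes the gap is the normal
  subgroup \<open>N\<close> of all elements \<open>n\<close> such that some element of \<open>G\<close> acts as \<open>n\<close> below one vertex
  and trivially below its siblings: \<open>b\<^sup>s\<close> may be replaced by \<open>n b\<^sup>s\<close> for any \<open>n \<in> N\<close>. The
  commutator of \<open>a\<close> and \<open>b\<close> is central modulo \<open>N\<close> (\<open>comm_central_mod\<close>), and in such a group of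
  class two an element with exponent sums \<open>0\<close> in \<open>a\<close> and \<open>s \<noteq> 0\<close> in \<open>b\<close> is conjugate to
  \<open>b\<^sup>s\<close> by a power of \<open>a\<close>. So a conjugate of \<open>h\<close> is of the form \<open>n b\<^sup>s\<close>.

  All these arguments use only the rotations and sections of the elements. They are carried out
  for abstract groups with such data, to which subgroups of the automorphism group of the tree
  are then shown to belong.
\<close>

section \<open>Self-similar groups with cyclic action on the first level\<close>

text \<open>The stabilizers of the levels, phrased through rotations and sections alone. The predicate does not
mention the group, so it is the same for a group and for its subgroups.\<close>

primrec fixes_level :: "nat \<Rightarrow> ('a \<Rightarrow> int) \<Rightarrow> ('a \<Rightarrow> int \<Rightarrow> 'a) \<Rightarrow> nat \<Rightarrow> 'a \<Rightarrow> bool"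
  where
    "fixes_level p rot sec 0 g \<longleftrightarrow> True"
  | "fixes_level p rot sec (Suc n) g \<longleftrightarrow>
      int p dvd rot g \<and> (\<forall>i. fixes_level p rot sec n (sec g i))"

text \<open>As \<open>c\<close> is invertible modulo the prime \<open>p\<close>, the points \<open>i, i + c, \<dots>, i + (p - 1) c\<close> meet every
residue class once.\<close>

lemma sum_along_rotation:
  fixes f :: "int \<Rightarrow> 'b::comm_monoid_add"
  assumes "Factorial_Ring.prime p" and "\<not> int p dvd c"
    and per: "\<And>i i'. [i = i'] (mod int p) \<Longrightarrow> f i = f i'"
  shows "(\<Sum>k<p. f (i + int k * c)) = (\<Sum>x\<in>{0..<int p}. f x)"
proof -
  have p0: "p > 0" using assms(1) prime_gt_0_nat by blast
  have cop: "coprime c (int p)"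
    using assms(1,2) by (metis coprime_commute prime_imp_coprime prime_nat_int_transfer)
  have inj: "inj_on (\<lambda>k. (i + int k * c) mod int p) {..<p}"
  proof (rule inj_onI)
    fix k l assume k: "k \<in> {..<p}" and l: "l \<in> {..<p}"
      and eq: "(i + int k * c) mod int p = (i + int l * c) mod int p"
    have "[int k * c = int l * c] (mod int p)"
      using eq cong_add_lcancel unfolding cong_def[symmetric] by blast
    then have "[int k = int l] (mod int p)" using cop cong_mult_rcancel by blast
    then show "k = l" using k l by (simp add: cong_int_iff cong_less_modulus_unique_nat)
  qed
  have sub: "(\<lambda>k. (i + int k * c) mod int p) ` {..<p} \<subseteq> {0..<int p}" using p0 by auto
  have "bij_betw (\<lambda>k. (i + int k * c) mod int p) {..<p} {0..<int p}"
    unfolding bij_betw_def using inj card_subset_eq[OF _ sub] by (simp add: card_image)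
  then have "(\<Sum>k<p. f ((i + int k * c) mod int p)) = (\<Sum>x\<in>{0..<int p}. f x)"
    by (rule sum.reindex_bij_betw)
  moreover have "f ((i + int k * c) mod int p) = f (i + int k * c)" for k
    by (rule per) (simp add: cong_def)
  ultimately show ?thesis by simp
qed

lemma sum_shift_mod:
  fixes f :: "int \<Rightarrow> 'b::comm_monoid_add"
  assumes "Factorial_Ring.prime p"
    and per: "\<And>i i'. [i = i'] (mod int p) \<Longrightarrow> f i = f i'"
  shows "(\<Sum>x\<in>{0..<int p}. f (x + c)) = (\<Sum>x\<in>{0..<int p}. f x)"
proof -
  have 1: "\<not> int p dvd 1" using assms(1) prime_gt_1_nat by fastforce
  have "(\<Sum>x\<in>{0..<int p}. f (x + c)) = (\<Sum>k<p. f (0 + int k * 1 + c))"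
    by (rule sum_along_rotation[OF assms(1) 1, symmetric]) (intro per cong_add cong_refl)
  also have "\<dots> = (\<Sum>k<p. f (c + int k * 1))" by (simp add: add.commute)
  also have "\<dots> = (\<Sum>x\<in>{0..<int p}. f x)"
    by (rule sum_along_rotation[OF assms(1) 1 per])
  finally show ?thesis .
qed

lemma (in group) inv_left_cancel [simp]: "\<lbrakk>x \<in> carrier G; y \<in> carrier G\<rbrakk> \<Longrightarrow> inv x \<otimes> (x \<otimes> y) = y"
  by (simp add: m_assoc[symmetric])

lemma (in group) inv_right_cancel [simp]: "\<lbrakk>x \<in> carrier G; y \<in> carrier G\<rbrakk> \<Longrightarrow> x \<otimes> (inv x \<otimes> y) = y"
  by (simp add: m_assoc[symmetric])

text \<open>The letters are indexed by residues modulo \<open>p\<close>, represented by arbitrary integers: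
\<open>g\<close> moves the letter \<open>i\<close> to \<open>i + rot g\<close> and has the section \<open>sec g i\<close> there. Working with all
integers keeps reductions modulo \<open>p\<close> out of the terms. The last assumption says that the
action on the tree is faithful.\<close>

locale cyclic_self_similar = group G for G (structure) +
  fixes p :: nat and rot :: "'a \<Rightarrow> int" and sec :: "'a \<Rightarrow> int \<Rightarrow> 'a" and a :: 'a
  assumes prime_p: "Factorial_Ring.prime p"
    and rot_mult: "\<lbrakk>x \<in> carrier G; y \<in> carrier G\<rbrakk> \<Longrightarrow> [rot (x \<otimes> y) = rot x + rot y] (mod int p)"
    and sec_closed [simp, intro]: "x \<in> carrier G \<Longrightarrow> sec x i \<in> carrier G"
    and sec_mult:
      "\<lbrakk>x \<in> carrier G; y \<in> carrier G\<rbrakk> \<Longrightarrow> sec (x \<otimes> y) i = sec x i \<otimes> sec y (i + rot x)"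
    and sec_cong: "\<lbrakk>x \<in> carrier G; [i = i'] (mod int p)\<rbrakk> \<Longrightarrow> sec x i = sec x i'"
    and a_closed [simp, intro]: "a \<in> carrier G"
    and rot_a: "[rot a = 1] (mod int p)"
    and sec_a: "sec a i = \<one>"
    and separated: "\<lbrakk>x \<in> carrier G; \<And>n. fixes_level p rot sec n x\<rbrakk> \<Longrightarrow> x = \<one>"
begin

abbreviation St :: "nat \<Rightarrow> 'a \<Rightarrow> bool"
  where "St n x \<equiv> fixes_level p rot sec n x"

lemma p_gt_1: "p > 1" and p_gt_0: "p > 0"
  using prime_p prime_gt_1_nat prime_gt_0_nat by blast+

lemma sec_eq_at: "\<lbrakk>x \<in> carrier G; int p dvd i - i'\<rbrakk> \<Longrightarrow> sec x i = sec x i'"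
  by (rule sec_cong) (auto simp: cong_iff_dvd_diff)

lemma rot_one: "int p dvd rot \<one>"
  using rot_mult[of \<one> \<one>] by (simp add: cong_iff_dvd_diff)

lemma sec_one [simp]: "sec \<one> i = \<one>"
proof -
  have "sec \<one> i = sec \<one> i \<otimes> sec \<one> (i + rot \<one>)" using sec_mult[of \<one> \<one> i] by simp
  also have "sec \<one> (i + rot \<one>) = sec \<one> i" by (rule sec_eq_at) (simp_all add: rot_one)
  finally show ?thesis by (metis sec_closed one_closed l_cancel_one')
qed

lemma rot_inv: "x \<in> carrier G \<Longrightarrow> [rot (inv x) = - rot x] (mod int p)"
proof -
  assume x: "x \<in> carrier G"
  have "[rot \<one> = rot x + rot (inv x)] (mod int p)" using rot_mult[of x "inv x"] x by simp
  moreover have "[rot \<one> = 0] (mod int p)" using rot_one by (simp add: cong_0_iff)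
  ultimately have "[rot x + rot (inv x) = 0] (mod int p)"
    using cong_trans cong_sym by blast
  then show ?thesis by (simp add: cong_iff_dvd_diff add.commute)
qed

lemma sec_inv: "x \<in> carrier G \<Longrightarrow> sec (inv x) i = inv (sec x (i - rot x))"
proof -
  assume x: "x \<in> carrier G"
  have "sec x (i - rot x) \<otimes> sec (inv x) i = \<one>"
    using sec_mult[of x "inv x" "i - rot x"] x by simp
  then show ?thesis using x by (metis inv_equality inv_closed inv_inv sec_closed)
qed

lemma rot_pow: "x \<in> carrier G \<Longrightarrow> [rot (x [^] (k::nat)) = int k * rot x] (mod int p)"
proof (induction k)
  case 0 then show ?case using rot_one by (simp add: cong_0_iff)
next
  case (Suc k)
  have "[rot (x [^] Suc k) = rot (x [^] k) + rot x] (mod int p)"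
    using rot_mult Suc.prems by simp
  also have "[rot (x [^] k) + rot x = int k * rot x + rot x] (mod int p)"
    using Suc by (intro cong_add) auto
  finally show ?case by (simp add: algebra_simps)
qed

lemma rot_int_pow: "x \<in> carrier G \<Longrightarrow> [rot (x [^] (k::int)) = k * rot x] (mod int p)"
proof (cases k)
  case (nonneg n)
  assume "x \<in> carrier G"
  then show ?thesis using rot_pow[of x n] nonneg by (simp add: int_pow_int)
next
  case (neg n)
  assume x: "x \<in> carrier G"
  have "[rot (x [^] k) = - rot (x [^] Suc n)] (mod int p)"
    using rot_inv[of "x [^] Suc n"] x neg by (metis int_pow_neg_int nat_pow_closed)
  also have "[- rot (x [^] Suc n) = - (int (Suc n) * rot x)] (mod int p)"
    using rot_pow[OF x, of "Suc n"] by (simp only: cong_minus_minus_iff)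
  also have "- (int (Suc n) * rot x) = k * rot x" using neg by (simp only: minus_mult_left)
  finally show ?thesis .
qed

lemma sec_mult_fix: "\<lbrakk>x \<in> carrier G; y \<in> carrier G; int p dvd rot x\<rbrakk>
  \<Longrightarrow> sec (x \<otimes> y) i = sec x i \<otimes> sec y i"
  by (subst sec_mult) (auto intro!: arg_cong2[where f = "(\<otimes>)"] sec_eq_at)

lemma rot_mult_fix: "\<lbrakk>x \<in> carrier G; y \<in> carrier G; int p dvd rot x; int p dvd rot y\<rbrakk>
  \<Longrightarrow> int p dvd rot (x \<otimes> y)"
  using rot_mult[of x y] by (meson cong_dvd_iff dvd_add)

lemma rot_inv_fix: "\<lbrakk>x \<in> carrier G; int p dvd rot x\<rbrakk> \<Longrightarrow> int p dvd rot (inv x)"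
  using rot_inv[of x] by (meson cong_dvd_iff dvd_minus_iff)

lemma sec_inv_fix: "\<lbrakk>x \<in> carrier G; int p dvd rot x\<rbrakk> \<Longrightarrow> sec (inv x) i = inv (sec x i)"
  by (subst sec_inv) (auto intro!: arg_cong[where f = "\<lambda>x. inv x"] sec_eq_at)

lemma rot_pow_fix: "\<lbrakk>x \<in> carrier G; int p dvd rot x\<rbrakk> \<Longrightarrow> int p dvd rot (x [^] (k::nat))"
  using rot_pow[of x k] by (meson cong_dvd_iff dvd_mult)

lemma rot_int_pow_fix: "\<lbrakk>x \<in> carrier G; int p dvd rot x\<rbrakk> \<Longrightarrow> int p dvd rot (x [^] (k::int))"
  using rot_int_pow[of x k] by (meson cong_dvd_iff dvd_mult)

lemma sec_pow_fix: "\<lbrakk>x \<in> carrier G; int p dvd rot x\<rbrakk> \<Longrightarrow> sec (x [^] (k::nat)) i = sec x i [^] k"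
  by (induction k) (simp_all add: sec_mult_fix rot_pow_fix)

lemma sec_int_pow_fix: "\<lbrakk>x \<in> carrier G; int p dvd rot x\<rbrakk> \<Longrightarrow> sec (x [^] (k::int)) i = sec x i [^] k"
  by (cases k rule: int_cases2)
    (simp_all add: int_pow_neg_int int_pow_int sec_inv_fix rot_pow_fix sec_pow_fix)

lemma rot_pow_p: "x \<in> carrier G \<Longrightarrow> int p dvd rot (x [^] p)"
  using rot_pow[of x p] by (meson cong_dvd_iff dvd_triv_left)

lemma sec_a_pow [simp]: "sec (a [^] (k::nat)) i = \<one>"
  by (induction k) (simp_all add: sec_mult sec_a)

lemma sec_a_int_pow [simp]: "sec (a [^] (k::int)) i = \<one>"
  by (cases k rule: int_cases2) (simp_all add: int_pow_neg_int int_pow_int sec_inv)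

lemma rot_a_int_pow: "[rot (a [^] (k::int)) = k] (mod int p)"
  using cong_trans[OF rot_int_pow[OF a_closed, of k] cong_scalar_left[OF rot_a, of k]] by simp

lemma eq_one_if_trivial_sections:
  assumes x: "x \<in> carrier G" and "int p dvd rot x" and "\<And>i. sec x i = \<one>"
  shows "x = \<one>"
proof (rule separated[OF x])
  fix n
  have one: "St n \<one>" for n by (induction n) (simp_all add: rot_one)
  then show "St n x" using assms by (cases n) simp_all
qed

lemma St_one [simp]: "St n \<one>"
  by (induction n) (simp_all add: rot_one)

lemma St_mult: "\<lbrakk>x \<in> carrier G; y \<in> carrier G; St n x; St n y\<rbrakk> \<Longrightarrow> St n (x \<otimes> y)"
  by (induction n arbitrary: x y) (simp_all add: sec_mult_fix rot_mult_fix)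

lemma St_inv: "\<lbrakk>x \<in> carrier G; St n x\<rbrakk> \<Longrightarrow> St n (inv x)"
  by (induction n arbitrary: x) (simp_all add: sec_inv_fix rot_inv_fix)

lemma St_conj: "\<lbrakk>x \<in> carrier G; y \<in> carrier G; St n x\<rbrakk> \<Longrightarrow> St n (y \<otimes> x \<otimes> inv y)"
proof (induction n arbitrary: x y)
  case (Suc n)
  have xy: "x \<in> carrier G" "y \<in> carrier G" by fact+
  have rx: "int p dvd rot x" using Suc.prems by simp
  have "[rot (y \<otimes> x \<otimes> inv y) = rot y + rot x + - rot y] (mod int p)"
    using xy by (intro cong_trans[OF rot_mult] cong_add rot_mult rot_inv) auto
  then have r: "int p dvd rot (y \<otimes> x \<otimes> inv y)" using rx by (simp add: cong_dvd_iff)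
  have "sec (y \<otimes> x \<otimes> inv y) i = sec y i \<otimes> sec x (i + rot y) \<otimes> inv (sec y i)" for i
  proof -
    have "[rot (y \<otimes> x) = rot y + rot x] (mod int p)" using xy rot_mult by blast
    then have "int p dvd i + rot (y \<otimes> x) - rot y - i"
      using rx dvd_add[of "int p" "rot (y \<otimes> x) - (rot y + rot x)" "rot x"]
      by (simp add: cong_iff_dvd_diff algebra_simps)
    then have "sec y (i + rot (y \<otimes> x) - rot y) = sec y i" by (intro sec_eq_at xy)
    then show ?thesis using xy by (simp add: sec_mult sec_inv)
  qed
  then show ?case using r Suc by simp
qed simp

lemma St_pow: "\<lbrakk>x \<in> carrier G; St n x\<rbrakk> \<Longrightarrow> St n (x [^] (k::nat))"
  by (induction k) (simp_all add: St_mult)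

lemma St_mono: "\<lbrakk>St n x; m \<le> n\<rbrakk> \<Longrightarrow> St m x"
proof (induction m arbitrary: n x)
  case (Suc m) then show ?case by (cases n) auto
qed simp

lemma a_pow_p: "a [^] p = \<one>"
  by (rule eq_one_if_trivial_sections) (simp_all add: rot_pow_p)

lemma int_pow_mod_p:
  assumes x: "x \<in> carrier G" and "x [^] p = \<one>" and "[k = l] (mod int p)"
  shows "x [^] (k::int) = x [^] l"
proof -
  obtain q where "k = l + int p * q" using assms(3) by (metis cong_iff_lin cong_sym)
  moreover have "x [^] (int p * q) = \<one>"
    using x assms(2) int_pow_pow[of x "int p" q] by (simp add: int_pow_int)
  ultimately show ?thesis using x by (simp add: int_pow_mult)
qed

text \<open>The exponent of a power of \<open>a\<close> can be read off from its rotation.\<close>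

lemma rooted_pow_eq_rot:
  assumes "x = a [^] (k::int)" shows "x = a [^] rot x"
  unfolding assms
  by (rule int_pow_mod_p[OF a_closed a_pow_p cong_sym[OF rot_a_int_pow]])

subsection \<open>Powers of elements that move the first level\<close>

lemma sec_pow_Suc:
  assumes x: "x \<in> carrier G"
  shows "sec (x [^] Suc m) i = sec (x [^] m) i \<otimes> sec x (i + int m * rot x)"
proof -
  have "sec x (i + rot (x [^] m)) = sec x (i + int m * rot x)"
    by (intro sec_cong x cong_add cong_refl rot_pow)
  then show ?thesis using x by (simp add: sec_mult)
qed

lemma rot_sec_cong: "\<lbrakk>x \<in> carrier G; [i = i'] (mod int p)\<rbrakk> \<Longrightarrow> rot (sec x i) = rot (sec x i')"
  using sec_cong by metis

text \<open>Along the \<open>p\<close>-cycle all sections of \<open>x\<close> are multiplied, and rotations are additive.\<close>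

lemma rot_sec_pow_p:
  assumes x: "x \<in> carrier G" and "\<not> int p dvd rot x"
  shows "[rot (sec (x [^] p) i) = (\<Sum>k\<in>{0..<int p}. rot (sec x k))] (mod int p)"
proof -
  have "[rot (sec (x [^] m) i) = (\<Sum>k<m. rot (sec x (i + int k * rot x)))] (mod int p)" for m
  proof (induction m)
    case 0 then show ?case using rot_one by (simp add: cong_0_iff)
  next
    case (Suc m)
    show ?case unfolding sec_pow_Suc[OF x] using x Suc
      by (auto intro!: cong_trans[OF rot_mult] cong_add)
  qed
  from this[of p] show ?thesis
    by (subst (asm) sum_along_rotation[OF prime_p assms(2)]) (use x rot_sec_cong in blast)+
qed

text \<open>The product along the cycle becomes explicit when all sections but one are powers of \<open>a\<close>.
Reading the cycle from the exceptional letter \<open>j\<close> on puts the exceptional section in front, so that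
the powers of \<open>a\<close> merge and no conjugation remains.\<close>

lemma sec_pow_p_single:
  assumes x: "x \<in> carrier G" and nr: "\<not> int p dvd rot x"
    and pw: "\<And>i. \<not> int p dvd i - j \<Longrightarrow> sec x i = a [^] (v i :: int)"
    and vj: "\<And>i. int p dvd i - j \<Longrightarrow> v i = 0"
    and vper: "\<And>i i'. [i = i'] (mod int p) \<Longrightarrow> v i = v i'"
  shows "sec (x [^] p) j = sec x j \<otimes> a [^] (\<Sum>i\<in>{0..<int p}. v i)"
proof -
  have "sec (x [^] Suc m) j = sec x j \<otimes> a [^] (\<Sum>k<Suc m. v (j + int k * rot x))" if "Suc m \<le> p" for m
    using that
  proof (induction m)
    case 0 then show ?case using x by (simp add: vj)
  next
    case (Suc m)
    have "\<not> int p dvd int (Suc m)" using Suc.prems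
      by (meson dvd_imp_le int_dvd_int_iff not_less_eq_eq zero_less_Suc)
    then have "\<not> int p dvd int (Suc m) * rot x" using nr prime_p
      by (metis prime_dvd_mult_iff prime_nat_int_transfer)
    then have "sec x (j + int (Suc m) * rot x) = a [^] v (j + int (Suc m) * rot x)"
      by (intro pw) simp
    then show ?case using x Suc
      by (subst sec_pow_Suc) (simp_all add: m_assoc int_pow_mult)
  qed
  from this[of "p - 1"] show ?thesis
    using sum_along_rotation[where f = v and i = j, OF prime_p nr vper] p_gt_0 by simp
qed

subsection \<open>The exponent of the iterated wreath product\<close>

text \<open>The \<open>p\<close>-th power of an element fixes the first level, and powers of what remains are taken in the
sections.\<close>

theorem pow_fixes_level: "x \<in> carrier G \<Longrightarrow> St n (x [^] (p ^ n))"
proof (induction n arbitrary: x)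
  case (Suc n)
  have xp: "x [^] p \<in> carrier G" using Suc by simp
  have r: "int p dvd rot (x [^] p)" using Suc by (simp add: rot_pow_p)
  have "x [^] (p ^ Suc n) = (x [^] p) [^] (p ^ n)" using Suc by (simp add: nat_pow_pow)
  then show ?case using Suc.IH xp r by (simp add: rot_pow_fix sec_pow_fix)
qed simp

end

section \<open>Directed elements\<close>

context cyclic_self_similar
begin

text \<open>The shape shared by the directed automorphisms along the path of the letter \<open>j\<close>, with the defining
vector left unspecified. In this form it is visibly closed under products.\<close>

definition directed :: "int \<Rightarrow> 'a \<Rightarrow> bool"
  where "directed j b \<longleftrightarrow> b \<in> carrier G \<and> int p dvd rot b \<and> sec b j = b \<and>
    (\<forall>i. \<not> int p dvd i - j \<longrightarrow> (\<exists>k::int. sec b i = a [^] k))"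

lemma directedD:
  assumes "directed j b"
  shows "b \<in> carrier G" "int p dvd rot b" "int p dvd i - j \<Longrightarrow> sec b i = b"
    "\<not> int p dvd i - j \<Longrightarrow> \<exists>k::int. sec b i = a [^] k"
    "\<not> int p dvd i - j \<Longrightarrow> sec b i = a [^] rot (sec b i)"
  using assms sec_eq_at[of b i j] rooted_pow_eq_rot unfolding directed_def by metis+

lemma directed_cong:
  assumes b: "directed j b" and d: "int p dvd i - j"
  shows "directed i b"
proof -
  have "int p dvd l - i \<longleftrightarrow> int p dvd l - j" for l
    using dvd_add_left_iff[OF d, of "l - i"] by (simp add: algebra_simps)
  then show ?thesis using directedD[OF b] d unfolding directed_def by simp
qed

lemma directed_one: "directed j \<one>"
  using rot_one int_pow_0 by (auto simp: directed_def intro: exI[of _ "0::int"])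

lemma directed_mult:
  assumes x: "directed j x" and y: "directed j y"
  shows "directed j (x \<otimes> y)"
proof -
  note X = directedD[OF x] and Y = directedD[OF y]
  have "\<exists>k::int. sec (x \<otimes> y) i = a [^] k" if "\<not> int p dvd i - j" for i
    using X(4)[OF that] Y(4)[OF that] X(1,2) Y(1) by (metis a_closed int_pow_mult sec_mult_fix)
  then show ?thesis
    using X(1,2) Y(1,2) X(3)[of j] Y(3)[of j] by (simp add: directed_def rot_mult_fix sec_mult_fix)
qed

text \<open>The power \<open>b\<^sup>p\<close> reproduces itself at \<open>j\<close> and is trivial at the other letters, hence it is trivial on
all levels.\<close>

lemma directed_pow_p:
  assumes b: "directed j b"
  shows "b [^] p = \<one>"
proof (rule separated)
  note B = directedD[OF b]
  show "b [^] p \<in> carrier G" using B by simp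
  show "St n (b [^] p)" for n
  proof (induction n)
    case (Suc n)
    have "St n (sec (b [^] p) i)" for i
    proof (cases "int p dvd i - j")
      case True
      then show ?thesis using Suc B by (simp add: sec_pow_fix)
    next
      case False
      then obtain k :: int where "sec b i = a [^] k" using B(4) by blast
      then have "sec b i [^] p = (a [^] p) [^] k"
        by (metis a_closed int_pow_int int_pow_pow mult.commute)
      then show ?thesis using B by (simp add: sec_pow_fix a_pow_p)
    qed
    then show ?case using B by (simp add: rot_pow_p)
  qed simp
qed

text \<open>For a directed element this is the sum of the entries of its defining vector modulo \<open>p\<close>, as
\<open>rot (sec b j) = rot b\<close> vanishes.\<close>

definition rot_sum :: "'a \<Rightarrow> int"
  where "rot_sum x = (\<Sum>i\<in>{0..<int p}. rot (sec x i))"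

text \<open>The sections of \<open>y\<close> enter the product shifted by \<open>rot x\<close>, which does not affect their sum.\<close>

lemma rot_sum_mult:
  assumes x: "x \<in> carrier G" and y: "y \<in> carrier G"
  shows "[rot_sum (x \<otimes> y) = rot_sum x + rot_sum y] (mod int p)"
proof -
  have "[rot_sum (x \<otimes> y) = (\<Sum>i\<in>{0..<int p}. rot (sec x i) + rot (sec y (i + rot x)))] (mod int p)"
    unfolding rot_sum_def using x y by (intro cong_sum) (simp add: sec_mult rot_mult)
  also have "(\<Sum>i\<in>{0..<int p}. rot (sec x i) + rot (sec y (i + rot x)))
      = rot_sum x + (\<Sum>i\<in>{0..<int p}. rot (sec y (i + rot x)))"
    by (simp add: sum.distrib rot_sum_def)
  also have "(\<Sum>i\<in>{0..<int p}. rot (sec y (i + rot x))) = rot_sum y"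
    unfolding rot_sum_def by (rule sum_shift_mod[OF prime_p]) (rule rot_sec_cong[OF y])
  finally show ?thesis .
qed

text \<open>If the non-rooted sections of \<open>b\<close> multiply to a nontrivial rooted element then a
  product \<open>b \<otimes> a\<^sup>c\<close> with \<open>c \<noteq> 0\<close> reproduces itself, with the same kind of exponent, among
  the sections of its \<open>p\<close>-th power. Hence it attains the maximal order on every level.\<close>

lemma pow_not_fixes_level:
  assumes b: "directed j b" and nz: "\<not> int p dvd rot_sum b" and c: "\<not> int p dvd c"
  shows "\<not> St (Suc n) ((b \<otimes> a [^] (c::int)) [^] (p ^ n))"
  using c
proof (induction n arbitrary: c)
  note B = directedD[OF b]
  have rot: "[rot (b \<otimes> a [^] c) = c] (mod int p)" for c :: int
  proof -
    have "[rot (b \<otimes> a [^] c) = 0 + c] (mod int p)"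
      using B by (intro cong_trans[OF rot_mult] cong_add rot_a_int_pow) (auto simp: cong_0_iff)
    then show ?thesis by simp
  qed
  {
    case 0
    then show ?case using rot[of c] B by (simp add: cong_dvd_iff)
  next
    case (Suc n)
    let ?x = "b \<otimes> a [^] c" and ?v = "\<lambda>i. if int p dvd i - j then 0 else rot (sec b i)"
    have x: "?x \<in> carrier G" using B by simp
    have nr: "\<not> int p dvd rot ?x" using rot Suc.prems by (meson cong_dvd_iff)
    have sx: "sec ?x i = sec b i" for i using B by (simp add: sec_mult_fix)
    have per: "?v i = ?v i'" if "[i = i'] (mod int p)" for i i'
    proof -
      have "int p dvd i - j \<longleftrightarrow> int p dvd i' - j"
        using that by (intro cong_dvd_iff cong_diff) auto
      then show ?thesis using rot_sec_cong[OF B(1) that] by simp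
    qed
    have "[?v i = rot (sec b i)] (mod int p)" for i
      using B(2) B(3)[of i] by (cases "int p dvd i - j") (simp_all add: cong_0_iff cong_sym_eq[of 0])
    then have "[(\<Sum>i\<in>{0..<int p}. ?v i) = rot_sum b] (mod int p)"
      unfolding rot_sum_def by (rule cong_sum)
    then have s: "\<not> int p dvd (\<Sum>i\<in>{0..<int p}. ?v i)" using nz by (meson cong_dvd_iff)
    have "sec (?x [^] p) j = sec ?x j \<otimes> a [^] (\<Sum>i\<in>{0..<int p}. ?v i)"
      by (rule sec_pow_p_single[OF x nr]) (use sx B(5) per in auto)
    then have "sec (?x [^] p) j = b \<otimes> a [^] (\<Sum>i\<in>{0..<int p}. ?v i)" using sx B(3) by simp
    then have "\<not> St (Suc n) (sec (?x [^] p) j [^] (p ^ n))" using Suc.IH[OF s] by simp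
    moreover have "?x [^] (p ^ Suc n) = (?x [^] p) [^] (p ^ n)" using x by (simp add: nat_pow_pow)
    ultimately have "\<not> St (Suc n) (sec (?x [^] (p ^ Suc n)) j)"
      using x by (simp add: sec_pow_fix rot_pow_p del: fixes_level.simps)
    then show ?case by (subst fixes_level.simps) blast
  }
qed

end

section \<open>Groups generated by directed elements and the rooted cycle\<close>

text \<open>The index \<open>j\<close> ranges over all integers, so a letter has many indices; all its families but one may be
taken to be empty.\<close>

locale multi_EGS = cyclic_self_similar +
  fixes D :: "int \<Rightarrow> 'a set"
  assumes generated: "carrier G = generate G (insert a (\<Union>j. D j))"
    and directed_D: "b \<in> D j \<Longrightarrow> directed j b"
begin

lemma ex_unbounded_order_if_nonzero_sum:
  assumes "b \<in> D j" "\<not> int p dvd rot_sum b"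
  shows "\<exists>x\<in>carrier G. \<forall>n. \<not> St (Suc n) (x [^] (p ^ n))"
proof -
  have "\<not> int p dvd 1" using p_gt_1 by simp
  with pow_not_fixes_level[OF directed_D[OF assms(1)] assms(2), of 1]
  show ?thesis using directed_D[OF assms(1)] directedD(1) by (intro bexI[of _ "b \<otimes> a [^] (1::int)"]) auto
qed

end

locale zero_sum_multi_EGS = multi_EGS +
  assumes zero_sum: "b \<in> D j \<Longrightarrow> int p dvd rot_sum b"
begin

text \<open>The map \<open>rot_sum\<close> is a homomorphism to the integers modulo \<open>p\<close> that kills the generators.\<close>

lemma rot_sum_zero: "x \<in> carrier G \<Longrightarrow> int p dvd rot_sum x"
proof -
  have one: "int p dvd rot_sum \<one>" unfolding rot_sum_def using rot_one by simp
  have ra: "int p dvd rot_sum a" unfolding rot_sum_def using rot_one by (simp add: sec_a)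
  have sub: "generate G (insert a (\<Union>j. D j)) = carrier G" using generated by simp
  have rot_sum_inv: "int p dvd rot_sum (inv x)" if "x \<in> carrier G" "int p dvd rot_sum x" for x
    using rot_sum_mult[of x "inv x"] that one by (metis cong_dvd_iff dvd_add_right_iff inv_closed r_inv)
  assume "x \<in> carrier G"
  then have "x \<in> generate G (insert a (\<Union>j. D j))" using generated by simp
  then show ?thesis
  proof (induction rule: generate.induct)
    case (eng x y)
    then show ?case using rot_sum_mult[of x y] sub by (metis cong_dvd_iff dvd_add)
  next
    case (inv x)
    then have "x \<in> carrier G" "int p dvd rot_sum x"
      using ra zero_sum directedD(1)[OF directed_D] by auto
    then show ?case by (rule rot_sum_inv)
  qed (use ra zero_sum one in auto)
qed

lemma sec_pow_p_fixes:
  assumes "x \<in> carrier G" "\<not> int p dvd rot x"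
  shows "int p dvd rot (sec (x [^] p) i)"
  using rot_sec_pow_p[OF assms, of i] rot_sum_zero[OF assms(1)]
  unfolding rot_sum_def by (meson cong_dvd_iff)

subsection \<open>The upper bound for the exponent\<close>

text \<open>The two claims feed each other. An element that fixes the first level passes to arbitrary sections one
level down without spending a \<open>p\<close>-th power. One that moves the first level spends a \<open>p\<close>-th power, but then
reaches sections that fix the first level, which get the next level for free.\<close>

theorem pow_half_fixes_level:
  shows "x \<in> carrier G \<Longrightarrow> St n (x [^] (p ^ ((n + 1) div 2)))"
    and "x \<in> carrier G \<Longrightarrow> int p dvd rot x \<Longrightarrow> St n (x [^] (p ^ (n div 2)))"
proof (induction n arbitrary: x)
  case (Suc n)
  have fixed: "St (Suc n) (x [^] (p ^ (Suc n div 2)))" if "x \<in> carrier G" "int p dvd rot x" for x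
    using Suc.IH(1)[of "sec x i" for i] that by (simp add: rot_pow_fix sec_pow_fix)
  {
    case 2
    then show ?case by (rule fixed)
  next
    case 1
    show ?case
    proof (cases "int p dvd rot x")
      case True
      obtain d where d: "(Suc n + 1) div 2 = Suc n div 2 + d" 
        by (metis add.commute div_le_mono le_Suc_ex le_add1)
      have "x [^] (p ^ ((Suc n + 1) div 2)) = (x [^] (p ^ (Suc n div 2))) [^] (p ^ d)"
        unfolding d power_add using 1 by (simp only: nat_pow_pow)
      then show ?thesis using fixed[OF 1 True] 1 by (simp only: St_pow nat_pow_closed)
    next
      case False
      have e: "(Suc n + 1) div 2 = Suc (n div 2)" by simp
      have "x [^] (p ^ ((Suc n + 1) div 2)) = (x [^] p) [^] (p ^ (n div 2))"
        unfolding e using 1 by (simp add: nat_pow_pow)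
      then show ?thesis
        using Suc.IH(2)[of "sec (x [^] p) i" for i] sec_pow_p_fixes[OF 1 False] 1
        by (simp add: rot_pow_fix sec_pow_fix rot_pow_p)
    qed
  }
qed simp_all

subsection \<open>Periodicity\<close>

definition p_torsion :: "'a \<Rightarrow> bool"
  where "p_torsion x \<longleftrightarrow> (\<exists>k. x [^] (p ^ k) = \<one>)"

lemma p_torsion_mono: "\<lbrakk>x \<in> carrier G; x [^] (p ^ k) = \<one>; k \<le> l\<rbrakk> \<Longrightarrow> x [^] (p ^ l) = \<one>"
  by (metis le_add_diff_inverse nat_pow_one nat_pow_pow power_add)

lemma p_torsion_if_sections:
  assumes x: "x \<in> carrier G" and r: "int p dvd rot x" and t: "\<And>i. p_torsion (sec x i)"
  shows "p_torsion x"
proof -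
  obtain k where k: "\<And>i. sec x i [^] (p ^ k i) = \<one>" using t unfolding p_torsion_def by metis
  define K where "K = Max (k ` {0..<int p})"
  have "sec x i [^] (p ^ K) = \<one>" for i
  proof -
    have "i mod int p \<in> {0..<int p}" using p_gt_0 by simp
    then have "k (i mod int p) \<le> K" unfolding K_def by simp
    then have "sec x (i mod int p) [^] (p ^ K) = \<one>" using k x p_torsion_mono by blast
    then show ?thesis using sec_cong[OF x, of i "i mod int p"] by (simp add: cong_def)
  qed
  then have "sec (x [^] (p ^ K)) i = \<one>" for i using x r by (simp add: sec_pow_fix)
  then have "x [^] (p ^ K) = \<one>"
    using eq_one_if_trivial_sections[OF nat_pow_closed[OF x] rot_pow_fix[OF x r]] by blast
  then show ?thesis unfolding p_torsion_def by blast
qed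

lemma p_torsion_if_pow_p: "\<lbrakk>x \<in> carrier G; p_torsion (x [^] p)\<rbrakk> \<Longrightarrow> p_torsion x"
  unfolding p_torsion_def by (metis nat_pow_pow power_Suc)

text \<open>Words with \<open>r\<close> directed letters; powers of \<open>a\<close> are not counted. The variant \<open>unrooted\<close> below does
not contain \<open>a\<close> at all.\<close>

inductive syllables :: "nat \<Rightarrow> 'a \<Rightarrow> bool"
  where
    syllables_one: "syllables 0 \<one>"
  | syllables_a: "syllables r x \<Longrightarrow> syllables r (x \<otimes> a)"
  | syllables_b: "\<lbrakk>syllables r x; b \<in> D j\<rbrakk> \<Longrightarrow> syllables (Suc r) (x \<otimes> b)"

inductive unrooted :: "nat \<Rightarrow> 'a \<Rightarrow> bool"
  where
    unrooted_one: "unrooted 0 \<one>"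
  | unrooted_b: "\<lbrakk>unrooted r x; b \<in> D j\<rbrakk> \<Longrightarrow> unrooted (Suc r) (x \<otimes> b)"

lemma D_closed: "b \<in> D j \<Longrightarrow> b \<in> carrier G"
  using directed_D directedD(1) by blast

lemma syllables_closed: "syllables r x \<Longrightarrow> x \<in> carrier G"
  by (induction rule: syllables.induct) (auto intro: D_closed)

lemma unrooted_syllables: "unrooted r x \<Longrightarrow> syllables r x"
  by (induction rule: unrooted.induct) (auto intro: syllables.intros)

lemma syllables_mult:
  assumes x: "syllables r x"
  shows "syllables s y \<Longrightarrow> syllables (r + s) (x \<otimes> y)"
proof (induction rule: syllables.induct)
  case syllables_one
  then show ?case using x syllables_closed by simp
next
  case (syllables_a s y)
  then show ?case using syllables.syllables_a[of "r + s" "x \<otimes> y"] x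
    by (simp add: m_assoc syllables_closed)
next
  case (syllables_b s y b j)
  then show ?case using syllables.syllables_b[of "r + s" "x \<otimes> y" b j] x
    by (simp add: m_assoc syllables_closed D_closed)
qed

lemma syllables_pow: "syllables r x \<Longrightarrow> syllables (k * r) (x [^] (k::nat))"
proof (induction k)
  case (Suc k)
  then show ?case using syllables_mult[of "k * r" "x [^] k" r x] by (simp add: add.commute)
qed (simp add: syllables_one)

lemma syllables_a_pow: "syllables 0 (a [^] (k::int))"
proof -
  have "a [^] k = a [^] (k mod int p)"
    by (rule int_pow_mod_p) (simp_all add: a_pow_p cong_def)
  also have "\<dots> = a [^] nat (k mod int p)"
    using p_gt_0 int_pow_int[of G a "nat (k mod int p)"] by simp
  finally have e: "a [^] k = a [^] nat (k mod int p)" .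
  have "syllables 0 a" using syllables_a[OF syllables_one] by simp
  from syllables_pow[OF this] show ?thesis unfolding e by simp
qed

lemma ex_syllables: "x \<in> carrier G \<Longrightarrow> \<exists>r. syllables r x"
proof -
  have gen: "\<exists>r. syllables r h" if "h \<in> insert a (\<Union>j. D j)" for h
    using that syllables_a[OF syllables_one] syllables_b[OF syllables_one] D_closed by fastforce
  assume "x \<in> carrier G"
  then have "x \<in> generate G (insert a (\<Union>j. D j))" using generated by simp
  then show ?thesis
  proof (induction rule: generate.induct)
    case (inv h)
    then obtain r where r: "syllables r h" using gen by blast
    then have h: "h \<in> carrier G" by (rule syllables_closed)
    have "h [^] p = \<one>" using inv a_pow_p directed_D directed_pow_p by auto
    then have "h [^] (p - 1) \<otimes> h = \<one>" using h p_gt_0 nat_pow_Suc[of h "p - 1"] by simp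
    then have "inv h = h [^] (p - 1)" using h by (simp add: inv_equality)
    then show ?case using syllables_pow[OF r, of "p - 1"] by metis
  next
    case (eng x y)
    then show ?case using syllables_mult by blast
  qed (use gen syllables_one in auto)
qed

text \<open>Each directed letter survives in exactly one section and turns into a power of \<open>a\<close> in the others, so the
sections of a word share its directed letters among them.\<close>

lemma section_syllables:
  assumes "syllables r x"
  shows "\<exists>l. (\<forall>i\<in>{0..<int p}. syllables (l i) (sec x i)) \<and> (\<Sum>i\<in>{0..<int p}. l i) = r"
  using assms
proof (induction rule: syllables.induct)
  case syllables_one
  show ?case by (intro exI[of _ "\<lambda>_. 0"]) (simp add: syllables.syllables_one)
next
  case (syllables_a r x)
  then show ?case using syllables_closed by (simp add: sec_mult sec_a)
next
  case (syllables_b r x b j)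
  then obtain l where l: "\<And>i. i \<in> {0..<int p} \<Longrightarrow> syllables (l i) (sec x i)"
    and sum: "(\<Sum>i\<in>{0..<int p}. l i) = r" by blast
  have x: "x \<in> carrier G" using syllables_b by (simp add: syllables_closed)
  note B = directedD[OF directed_D[OF syllables_b.hyps(2)]]
  define i0 where "i0 = (j - rot x) mod int p"
  have i0: "i0 \<in> {0..<int p}" unfolding i0_def using p_gt_0 by simp
  have "syllables ((l(i0 := Suc (l i0))) i) (sec (x \<otimes> b) i)" if i: "i \<in> {0..<int p}" for i
  proof (cases "i = i0")
    case True
    have "int p dvd i0 + rot x - j"
      unfolding i0_def by (simp add: mod_eq_dvd_iff[symmetric] mod_simps)
    then show ?thesis using True syllables.syllables_b[OF l[OF i0] syllables_b.hyps(2)] x B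
      by (simp add: sec_mult)
  next
    case False
    have "\<not> int p dvd i + rot x - j"
    proof
      assume "int p dvd i + rot x - j"
      then have "[i = j - rot x] (mod int p)" by (simp add: cong_iff_dvd_diff algebra_simps)
      then show False using False i unfolding i0_def by (simp add: cong_def)
    qed
    then obtain k :: int where "sec b (i + rot x) = a [^] k" using B(4) by blast
    then show ?thesis using False syllables_mult[OF l[OF i] syllables_a_pow[of k]] x B
      by (simp add: sec_mult)
  qed
  moreover have "(\<Sum>i\<in>{0..<int p}. (l(i0 := Suc (l i0))) i) = Suc r"
    using sum i0 by (simp add: sum.remove[of _ i0])
  ultimately show ?case by blast
qed

text \<open>The sections of \<open>x\<close> share \<open>r\<close> directed letters, and each section of \<open>x\<^sup>p\<close> collects all of them.\<close>

lemma section_pow_p_syllables: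
  assumes s: "syllables r x" and nr: "\<not> int p dvd rot x"
  shows "syllables r (sec (x [^] p) i)"
proof -
  have x: "x \<in> carrier G" using s by (rule syllables_closed)
  obtain l where l: "\<And>i. i \<in> {0..<int p} \<Longrightarrow> syllables (l i) (sec x i)"
    and sum: "(\<Sum>i\<in>{0..<int p}. l i) = r" using section_syllables[OF s] by blast
  have l': "syllables (l (i mod int p)) (sec x i)" for i
    using l[of "i mod int p"] sec_cong[OF x, of i "i mod int p"] p_gt_0 by (simp add: cong_def)
  have "syllables (\<Sum>k<m. l ((i + int k * rot x) mod int p)) (sec (x [^] m) i)" for m
  proof (induction m)
    case 0 show ?case by (simp add: syllables_one)
  next
    case (Suc m)
    show ?case unfolding sec_pow_Suc[OF x] sum.lessThan_Suc by (intro syllables_mult Suc l')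
  qed
  from this[of p] have "syllables (\<Sum>i\<in>{0..<int p}. l (i mod int p)) (sec (x [^] p) i)"
    by (subst (asm) sum_along_rotation[OF prime_p nr, of "\<lambda>i. l (i mod int p)"]) 
      (simp_all add: cong_def)
  then show ?thesis using sum by simp
qed

text \<open>A section keeps all the directed letters only if none of them leaves a power of \<open>a\<close> in it, and the letter
\<open>a\<close> itself has trivial sections.\<close>

lemma section_shorter_or_unrooted:
  assumes "syllables r x"
  shows "(\<exists>s<r. syllables s (sec x i)) \<or> unrooted r (sec x i)"
  using assms
proof (induction rule: syllables.induct)
  case syllables_one
  show ?case by (simp add: unrooted_one)
next
  case (syllables_a r x)
  then show ?case using syllables_closed by (simp add: sec_mult sec_a)
next
  case (syllables_b r x b j)
  have x: "x \<in> carrier G" using syllables_b by (simp add: syllables_closed)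
  note B = directedD[OF directed_D[OF syllables_b.hyps(2)]]
  show ?case
  proof (cases "int p dvd i + rot x - j")
    case True
    then have "sec (x \<otimes> b) i = sec x i \<otimes> b" using x B by (simp add: sec_mult)
    then show ?thesis
      using syllables_b.IH syllables.syllables_b[OF _ syllables_b.hyps(2)]
        unrooted_b[OF _ syllables_b.hyps(2)] by (metis Suc_less_eq)
  next
    case False
    then obtain k :: int where "sec b (i + rot x) = a [^] k" using B(4) by blast
    then have "sec (x \<otimes> b) i = sec x i \<otimes> a [^] k" using x B by (simp add: sec_mult)
    moreover obtain s where "s \<le> r" "syllables s (sec x i)"
      using syllables_b.IH unrooted_syllables less_imp_le by blast
    ultimately have "syllables s (sec (x \<otimes> b) i)"
      using syllables_mult[OF _ syllables_a_pow] by force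
    then show ?thesis using \<open>s \<le> r\<close> by (meson le_imp_less_Suc)
  qed
qed

text \<open>An unrooted word fixes the first level, so the section at \<open>i\<close> keeps all the letters only if they are
all directed along the path of \<open>i\<close>, and then their product is directed as well.\<close>

lemma section_unrooted_shorter_or_directed:
  assumes "unrooted r x"
  shows "int p dvd rot x \<and> ((\<exists>s<r. syllables s (sec x i)) \<or> directed i x)"
  using assms
proof (induction rule: unrooted.induct)
  case unrooted_one
  show ?case by (simp add: directed_one rot_one)
next
  case (unrooted_b r x b j)
  have s: "syllables r x" using unrooted_b unrooted_syllables by blast
  have x: "x \<in> carrier G" using s by (simp add: syllables_closed)
  have b: "directed j b" using directed_D unrooted_b by blast
  note B = directedD[OF b]
  have rot: "int p dvd rot (x \<otimes> b)" using unrooted_b.IH B x by (simp add: rot_mult_fix)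
  show ?case
  proof (cases "int p dvd i - j")
    case True
    then have "directed i b" using b directed_cong by blast
    moreover have "sec (x \<otimes> b) i = sec x i \<otimes> b" using True x B unrooted_b.IH by (simp add: sec_mult_fix)
    ultimately show ?thesis
      using unrooted_b.IH syllables_b[OF _ unrooted_b.hyps(2)] directed_mult[of i x b] rot
      by (auto intro: exI[of _ "Suc _"])
  next
    case False
    then obtain k :: int where "sec b i = a [^] k" using B(4) by blast
    then have e: "sec (x \<otimes> b) i = sec x i \<otimes> a [^] k"
      using x B unrooted_b.IH by (simp add: sec_mult_fix)
    obtain t where "t \<le> r" "syllables t (sec x i)"
      using unrooted_b.IH s unfolding directed_def by (metis le_refl less_imp_le)
    then have "syllables t (sec (x \<otimes> b) i)" using e syllables_mult[OF _ syllables_a_pow] by force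
    then show ?thesis using \<open>t \<le> r\<close> rot by (meson le_imp_less_Suc)
  qed
qed

text \<open>Induction on the number of directed letters. For unrooted words the sections are shorter, unless the word is
a directed element, of order \<open>p\<close>. For words that fix the first level the sections are shorter or unrooted.
For the other words the sections of the \<open>p\<close>-th power have the same number of letters, but they fix the first
level because the rotations of the sections add up to zero.\<close>

theorem periodic: "x \<in> carrier G \<Longrightarrow> p_torsion x"
proof -
  have main: "p_torsion x" if "syllables r x" for r x
    using that
  proof (induction r arbitrary: x rule: less_induct)
    case (less r)
    have unr: "p_torsion x" if u: "unrooted r x" for x
    proof (cases "\<exists>i. directed i x")
      case True
      then show ?thesis using directed_pow_p unfolding p_torsion_def by (intro exI[of _ 1]) auto
    next
      case False
      have x: "x \<in> carrier G" using u unrooted_syllables syllables_closed by blast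
      have "p_torsion (sec x i)" for i
        using section_unrooted_shorter_or_directed[OF u, of i] False less.IH by blast
      then show ?thesis
        using p_torsion_if_sections[OF x] section_unrooted_shorter_or_directed[OF u] by blast
    qed
    have fixed: "p_torsion x" if s: "syllables r x" and "int p dvd rot x" for x
    proof (rule p_torsion_if_sections)
      show "p_torsion (sec x i)" for i
        using section_shorter_or_unrooted[OF s, of i] less.IH unr by blast
    qed (use that syllables_closed in auto)
    show ?case
    proof (cases "int p dvd rot x")
      case True
      then show ?thesis using fixed less.prems by blast
    next
      case False
      have x: "x \<in> carrier G" using less.prems syllables_closed by blast
      have "p_torsion (sec (x [^] p) i)" for i
        using section_pow_p_syllables[OF less.prems False] sec_pow_p_fixes[OF x False]
        by (rule fixed)
      then have "p_torsion (x [^] p)"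
        using p_torsion_if_sections[OF nat_pow_closed[OF x] rot_pow_p[OF x]] by blast
      then show ?thesis using x p_torsion_if_pow_p by blast
    qed
  qed
  assume "x \<in> carrier G"
  then show ?thesis using ex_syllables main by blast
qed

end

section \<open>Groups of nilpotency class two\<close>

text \<open>The exponent sums belong to a way of writing the element as a word in \<open>x\<close> and \<open>y\<close>; as the element may
have several such words, this is a relation.\<close>

inductive exponent_sums ::
  "('a, 'c) monoid_scheme \<Rightarrow> 'a \<Rightarrow> 'a \<Rightarrow> int \<Rightarrow> int \<Rightarrow> 'a \<Rightarrow> bool"
  for G (structure) and x y
  where
    exponent_sums_one: "exponent_sums G x y 0 0 \<one>"
  | exponent_sums_fst: "exponent_sums G x y 1 0 x"
  | exponent_sums_snd: "exponent_sums G x y 0 1 y"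
  | exponent_sums_mult: "\<lbrakk>exponent_sums G x y i s v; exponent_sums G x y i' s' w\<rbrakk>
      \<Longrightarrow> exponent_sums G x y (i + i') (s + s') (v \<otimes> w)"
  | exponent_sums_inv: "exponent_sums G x y i s v \<Longrightarrow> exponent_sums G x y (- i) (- s) (inv v)"

context group
begin

lemma exponent_sums_closed:
  "\<lbrakk>exponent_sums G x y i s w; x \<in> carrier G; y \<in> carrier G\<rbrakk> \<Longrightarrow> w \<in> carrier G"
  by (induction rule: exponent_sums.induct) auto

lemma exponent_sums_generate:
  assumes "w \<in> generate G {x, y}"
  shows "\<exists>i s. exponent_sums G x y i s w"
  using assms by (induction rule: generate.induct) (blast intro: exponent_sums.intros)+

lemma exponent_sums_int_pow:
  assumes "x \<in> carrier G" "y \<in> carrier G" and w: "exponent_sums G x y i s w"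
  shows "exponent_sums G x y (k * i) (k * s) (w [^] (k::int))"
proof -
  have nat: "exponent_sums G x y (int n * i) (int n * s) (w [^] n)" for n :: nat
  proof (induction n)
    case 0 show ?case using exponent_sums_one by simp
  next
    case (Suc n)
    from exponent_sums_mult[OF this w] show ?case by (simp add: algebra_simps)
  qed
  have w': "w \<in> carrier G" using assms exponent_sums_closed by blast
  show ?thesis
  proof (cases k rule: int_cases2)
    case (nonneg n)
    then show ?thesis using nat by (simp add: int_pow_int)
  next
    case (nonpos n)
    then show ?thesis using exponent_sums_inv[OF nat[of n]] w' by (simp add: int_pow_neg_int)
  qed
qed

lemma conj_int_pow:
  assumes x: "x \<in> carrier G" and y: "y \<in> carrier G"
  shows "(inv y \<otimes> x \<otimes> y) [^] (k::int) = inv y \<otimes> x [^] k \<otimes> y"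
proof -
  have nat: "(inv y \<otimes> x \<otimes> y) [^] n = inv y \<otimes> x [^] n \<otimes> y" for n :: nat
    by (induction n) (simp_all add: x y m_assoc)
  show ?thesis
    using nat by (cases k rule: int_cases2)
      (simp_all add: x y int_pow_int int_pow_neg_int inv_mult_group m_assoc)
qed

lemma commute_int_pow:
  assumes "x \<in> carrier G" "y \<in> carrier G" "x \<otimes> y = y \<otimes> x"
  shows "x \<otimes> y [^] (k::int) = y [^] k \<otimes> x"
proof -
  have "inv x \<otimes> y \<otimes> x = y" using assms by (metis inv_solve_left m_assoc m_closed inv_closed)
  then have "inv x \<otimes> y [^] k \<otimes> x = y [^] k" using conj_int_pow[of y x k] assms by simp
  then show ?thesis using assms by (metis inv_solve_left m_assoc m_closed inv_closed int_pow_closed)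
qed

lemma commute_int_pow2:
  assumes "x \<in> carrier G" "y \<in> carrier G" "x \<otimes> y = y \<otimes> x"
  shows "x [^] (l::int) \<otimes> y [^] (k::int) = y [^] k \<otimes> x [^] l"
  using commute_int_pow[OF assms] commute_int_pow[of "y [^] k" x l] assms by simp

lemma commute_mult:
  assumes "x \<in> carrier G" "y \<in> carrier G" "z \<in> carrier G"
    and "x \<otimes> y = y \<otimes> x" "x \<otimes> z = z \<otimes> x"
  shows "x \<otimes> (y \<otimes> z) = (y \<otimes> z) \<otimes> x"
  using assms by (metis m_assoc)

context
  fixes x y c
  assumes x [simp]: "x \<in> carrier G" and y [simp]: "y \<in> carrier G" and c [simp]: "c \<in> carrier G"
    and yx: "y \<otimes> x = x \<otimes> y \<otimes> c" and cx: "c \<otimes> x = x \<otimes> c" and cy: "c \<otimes> y = y \<otimes> c"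
begin

lemma swap_powers_class_two: "y [^] (s::int) \<otimes> x [^] (i::int) = x [^] i \<otimes> y [^] s \<otimes> c [^] (s * i)"
proof -
  have "inv x \<otimes> y \<otimes> x = y \<otimes> c" using yx by (simp add: m_assoc inv_solve_left')
  then have "inv x \<otimes> y [^] s \<otimes> x = y [^] s \<otimes> c [^] s"
    using conj_int_pow[of y x s] int_pow_mult_distrib[of y c s] cy by simp
  then have 1: "y [^] s \<otimes> x = x \<otimes> (y [^] s \<otimes> c [^] s)" by (simp add: m_assoc inv_solve_left')
  have c1: "c [^] s \<otimes> x = x \<otimes> c [^] s" using commute_int_pow[of x c s] cx by simp
  have c2: "c [^] s \<otimes> y [^] s = y [^] s \<otimes> c [^] s" using commute_int_pow2[of c y s s] cy by simp
  have "y [^] s \<otimes> x = x \<otimes> c [^] s \<otimes> y [^] s" using 1 c2 by (simp add: m_assoc)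
  then have "y [^] s \<otimes> x \<otimes> inv (y [^] s) = x \<otimes> c [^] s" by (simp add: inv_solve_right')
  then have "y [^] s \<otimes> x [^] i \<otimes> inv (y [^] s) = (x \<otimes> c [^] s) [^] i"
    using conj_int_pow[of x "inv (y [^] s)" i] by simp
  also have "\<dots> = x [^] i \<otimes> c [^] (s * i)"
    using int_pow_mult_distrib[of x "c [^] s" i] c1 int_pow_pow[of c s i] by simp
  finally have "y [^] s \<otimes> x [^] i = x [^] i \<otimes> c [^] (s * i) \<otimes> y [^] s"
    by (simp add: inv_solve_right')
  also have "c [^] (s * i) \<otimes> y [^] s = y [^] s \<otimes> c [^] (s * i)"
    using commute_int_pow2[of c y "s * i" s] cy by simp
  then have "x [^] i \<otimes> c [^] (s * i) \<otimes> y [^] s = x [^] i \<otimes> y [^] s \<otimes> c [^] (s * i)"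
    by (simp add: m_assoc)
  finally show ?thesis .
qed

lemma normal_form_class_two:
  assumes "exponent_sums G x y i s w"
  shows "\<exists>u::int. w = x [^] i \<otimes> y [^] s \<otimes> c [^] u"
  using assms
proof (induction rule: exponent_sums.induct)
  case (exponent_sums_mult i s v i' s' w)
  then obtain u u' :: int where v: "v = x [^] i \<otimes> y [^] s \<otimes> c [^] u"
    and w: "w = x [^] i' \<otimes> y [^] s' \<otimes> c [^] u'" by blast
  have cx': "c [^] k \<otimes> (x [^] i' \<otimes> z) = x [^] i' \<otimes> (c [^] k \<otimes> z)" if "z \<in> carrier G" for z and k :: int
    using commute_int_pow2[of c x k i'] cx that by (simp add: m_assoc[symmetric])
  have cy': "c [^] k \<otimes> (y [^] s' \<otimes> z) = y [^] s' \<otimes> (c [^] k \<otimes> z)" if "z \<in> carrier G" for z and k :: int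
    using commute_int_pow2[of c y k s'] cy that by (simp add: m_assoc[symmetric])
  have yx': "y [^] s \<otimes> (x [^] i' \<otimes> z) = x [^] i' \<otimes> (y [^] s \<otimes> (c [^] (s * i') \<otimes> z))"
    if "z \<in> carrier G" for z
    using swap_powers_class_two[of s i'] that by (simp add: m_assoc[symmetric])
  have "v \<otimes> w = x [^] (i + i') \<otimes> y [^] (s + s') \<otimes> c [^] (s * i' + u + u')"
    unfolding v w by (simp add: int_pow_mult m_assoc cx' cy' yx')
  then show ?case by blast
next
  case (exponent_sums_inv i s v)
  then obtain u :: int where v: "v = x [^] i \<otimes> y [^] s \<otimes> c [^] u" by blast
  have "inv v = c [^] (- u) \<otimes> (y [^] (- s) \<otimes> x [^] (- i))"
    unfolding v by (simp add: inv_mult_group int_pow_neg)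
  also have "\<dots> = c [^] (- u) \<otimes> (x [^] (- i) \<otimes> y [^] (- s) \<otimes> c [^] (s * i))"
    using swap_powers_class_two[of "- s" "- i"] by simp
  also have "\<dots> = x [^] (- i) \<otimes> y [^] (- s) \<otimes> c [^] (s * i) \<otimes> c [^] (- u)"
  proof -
    have "c \<otimes> (x [^] (- i) \<otimes> y [^] (- s) \<otimes> c [^] (s * i))
        = (x [^] (- i) \<otimes> y [^] (- s) \<otimes> c [^] (s * i)) \<otimes> c"
      using cx cy by (intro commute_mult commute_int_pow) auto
    then show ?thesis
      using commute_int_pow[of "x [^] (- i) \<otimes> y [^] (- s) \<otimes> c [^] (s * i)" c "- u"] by simp
  qed
  also have "\<dots> = x [^] (- i) \<otimes> y [^] (- s) \<otimes> c [^] (s * i - u)"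
    by (simp add: m_assoc int_pow_mult[symmetric])
  finally show ?case by blast
qed (auto intro: exI[of _ "0::int"])

text \<open>The word has the form \<open>y\<^sup>s c\<^sup>u\<close>, and conjugation of \<open>y\<^sup>s\<close> by \<open>x\<^sup>t\<close> multiplies it by \<open>c\<^bsup>s t\<^esup>\<close>. As
\<open>x\<^sup>p = 1\<close> forces \<open>c\<^sup>p = 1\<close>, it is enough to solve \<open>s t = u\<close> modulo \<open>p\<close>.\<close>

lemma conj_to_power_class_two:
  assumes w: "exponent_sums G x y 0 s w" and p: "Factorial_Ring.prime p" and xp: "x [^] p = \<one>"
    and s: "\<not> int p dvd s"
  shows "\<exists>t::int. w = inv (x [^] t) \<otimes> y [^] s \<otimes> x [^] t"
proof -
  obtain u :: int where u: "w = y [^] s \<otimes> c [^] u" using normal_form_class_two[OF w] by auto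
  have conj: "inv (x [^] t) \<otimes> y [^] s \<otimes> x [^] t = y [^] s \<otimes> c [^] (s * t)" for s t :: int
    using swap_powers_class_two[of s t] by (simp add: m_assoc inv_solve_left')
  \<comment> \<open>Conjugating \<open>y\<close> by \<open>x\<^sup>p = 1\<close> multiplies it by \<open>c\<^sup>p\<close>.\<close>
  have "c [^] int p = \<one>" using conj[of "int p" 1] xp by (simp add: int_pow_int)
  have "coprime s (int p)"
    using p s by (metis coprime_commute prime_imp_coprime prime_nat_int_transfer)
  then obtain r where "[s * r = 1] (mod int p)" using cong_solve_coprime_int by blast
  then have "[s * (r * u) = 1 * u] (mod int p)" unfolding mult.assoc[symmetric] by (rule cong_scalar_right)
  then obtain q where "s * (r * u) = u + int p * q" by (metis cong_iff_lin cong_sym mult_1)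
  moreover have "c [^] (int p * q) = \<one>"
    using \<open>c [^] int p = \<one>\<close> int_pow_pow[of c "int p" q] by simp
  ultimately have "c [^] (s * (r * u)) = c [^] u" by (simp add: int_pow_mult)
  then show ?thesis using conj[of "r * u" s] u by metis
qed

end

end

section \<open>Elements of large order when the exponent sum is zero\<close>

text \<open>One directed generator \<open>b\<close>, normalised so that its section at distance \<open>d\<close> from \<open>j\<close> is \<open>a\<close> itself. Any
nonzero defining vector attains this after replacing \<open>b\<close> by a power.\<close>

locale zero_sum_GGS = cyclic_self_similar +
  fixes b :: 'a and j d :: int
  assumes generated_ab: "carrier G = generate G {a, b}"
    and directed_b: "directed j b"
    and rot_sum_b: "int p dvd rot_sum b"
    and section_one: "[rot (sec b (j + d)) = 1] (mod int p)"
begin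

text \<open>The entries of the defining vector, continued by \<open>e 0 = 0\<close> to all residues modulo \<open>p\<close>; sections are
counted from the letter \<open>j\<close> on.\<close>

definition e :: "int \<Rightarrow> int"
  where "e i = rot (sec b (j + i))"

definition T :: "'a \<Rightarrow> int \<Rightarrow> 'a"
  where "T x i = sec x (j + i)"

text \<open>The conjugate of \<open>b\<close> whose directed section sits at distance \<open>m\<close> from \<open>j\<close>.\<close>

definition \<beta> :: "int \<Rightarrow> 'a"
  where "\<beta> m = a [^] (- m) \<otimes> b \<otimes> a [^] m"

lemma b_closed [simp, intro]: "b \<in> carrier G"
  and rot_b: "int p dvd rot b"
  using directedD[OF directed_b] by auto

lemma prime_int_p: "Factorial_Ring.prime (int p)"
  using prime_p by simp

lemma b_pow_p: "b [^] p = \<one>"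
  using directed_b by (rule directed_pow_p)

lemma e_cong: "[i = i'] (mod int p) \<Longrightarrow> e i = e i'"
  unfolding e_def by (intro rot_sec_cong cong_add) auto

lemma e_zero: "int p dvd i \<Longrightarrow> int p dvd e i"
  unfolding e_def using directedD(2)[OF directed_b] directedD(3)[OF directed_b, of "j + i"] by simp

lemma e_d: "[e d = 1] (mod int p)"
  using section_one unfolding e_def .

lemma e_sum: "int p dvd (\<Sum>i\<in>{0..<int p}. e i)"
proof -
  have "(\<Sum>i\<in>{0..<int p}. rot (sec b (i + j))) = rot_sum b"
    unfolding rot_sum_def by (rule sum_shift_mod[OF prime_p]) (rule rot_sec_cong[OF b_closed])
  then show ?thesis using rot_sum_b unfolding e_def by (simp add: add.commute)
qed

lemma d_nonzero: "\<not> int p dvd d"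
  using e_zero[of d] e_d p_gt_1 by (auto simp: cong_dvd_iff)

text \<open>If all entries were \<open>0\<close> or \<open>1\<close>, their sum would be the number of ones, which lies strictly between \<open>0\<close>
and \<open>p\<close>.\<close>

lemma ex_other_exponent: "\<exists>u. \<not> int p dvd e u \<and> \<not> [e u = 1] (mod int p)"
proof (rule ccontr)
  assume H: "\<not> ?thesis"
  have val: "e u mod int p \<in> {0, 1}" for u
    using H p_gt_1 by (auto simp: dvd_eq_mod_eq_0 cong_def)
  let ?s = "\<Sum>i\<in>{0..<int p}. e i mod int p"
  have dvd: "int p dvd ?s" using e_sum by (simp add: dvd_eq_mod_eq_0 mod_sum_eq)
  have zero: "e 0 mod int p = 0" using e_zero[of 0] by (simp add: dvd_eq_mod_eq_0)
  have split: "{0..<int p} = insert 0 {1..<int p}" using p_gt_1 by auto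
  have "?s = (\<Sum>i\<in>{1..<int p}. e i mod int p)" unfolding split by (simp add: zero)
  also have "\<dots> \<le> (\<Sum>i\<in>{1..<int p}. 1)"
    using val by (intro sum_mono) (metis empty_iff insert_iff order_refl zero_le_one)
  finally have less: "?s < int p" using p_gt_1 by simp
  have "e (d mod int p) mod int p = 1"
    using e_cong[of "d mod int p" d] e_d p_gt_1 by (simp add: cong_def)
  moreover have "d mod int p \<in> {0..<int p}" using p_gt_1 by simp
  ultimately have "1 \<le> ?s"
    using val p_gt_0 member_le_sum[of "d mod int p" "{0..<int p}" "\<lambda>i. e i mod int p"] by simp
  then show False using dvd less zdvd_not_zless by fastforce
qed

text \<open>The prime \<open>2\<close> is excluded: modulo \<open>2\<close> every entry is \<open>0\<close> or \<open>1\<close>.\<close>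

lemma two_d_nonzero: "\<not> int p dvd 2 * d"
proof
  assume "int p dvd 2 * d"
  then have "int p dvd 2" using d_nonzero prime_dvd_multD[OF prime_int_p] by blast
  then have p2: "int p = 2" using p_gt_1 zdvd_imp_le[of "int p" 2] by simp
  obtain u where "\<not> int p dvd e u" "\<not> [e u = 1] (mod int p)" using ex_other_exponent by blast
  then show False unfolding p2 cong_iff_dvd_diff by simp
qed

lemma T_closed [simp, intro]: "x \<in> carrier G \<Longrightarrow> T x i \<in> carrier G"
  unfolding T_def by simp

lemma T_mult: "\<lbrakk>x \<in> carrier G; y \<in> carrier G; int p dvd rot x\<rbrakk> \<Longrightarrow> T (x \<otimes> y) i = T x i \<otimes> T y i"
  unfolding T_def by (rule sec_mult_fix)

lemma T_inv: "\<lbrakk>x \<in> carrier G; int p dvd rot x\<rbrakk> \<Longrightarrow> T (inv x) i = inv (T x i)"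
  unfolding T_def by (rule sec_inv_fix)

lemma T_int_pow: "\<lbrakk>x \<in> carrier G; int p dvd rot x\<rbrakk> \<Longrightarrow> T (x [^] (k::int)) i = T x i [^] k"
  unfolding T_def by (rule sec_int_pow_fix)

lemma T_cong: "\<lbrakk>x \<in> carrier G; int p dvd i - i'\<rbrakk> \<Longrightarrow> T x i = T x i'"
  unfolding T_def by (rule sec_eq_at) (simp_all add: algebra_simps)

lemma T_b: "T b i = (if int p dvd i then b else a [^] e i)"
  unfolding T_def e_def using directedD(3,5)[OF directed_b, of "j + i"] by simp

lemma rot_conj_a:
  assumes x: "x \<in> carrier G" and r: "int p dvd rot x"
  shows "int p dvd rot (a [^] (- m) \<otimes> x \<otimes> a [^] (m::int))"
proof -
  have "[rot (a [^] (- m) \<otimes> x \<otimes> a [^] m) = - m + rot x + m] (mod int p)"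
    using x by (intro cong_trans[OF rot_mult] cong_add rot_mult rot_a_int_pow) auto
  then show ?thesis using r by (simp add: cong_dvd_iff)
qed

lemma T_conj_a:
  assumes x: "x \<in> carrier G" and r: "int p dvd rot x"
  shows "T (a [^] (- m) \<otimes> x \<otimes> a [^] (m::int)) i = T x (i - m)"
proof -
  have "sec x (j + i + rot (a [^] (- m))) = sec x (j + i + - m)"
    using x by (intro sec_cong cong_add cong_refl rot_a_int_pow)
  then show ?thesis using x unfolding T_def by (simp add: sec_mult algebra_simps)
qed

lemma \<beta>_closed [simp, intro]: "\<beta> m \<in> carrier G"
  and rot_\<beta>: "int p dvd rot (\<beta> m)"
  and T_\<beta>: "T (\<beta> m) i = (if int p dvd i - m then b else a [^] e (i - m))"
  unfolding \<beta>_def using rot_conj_a[OF b_closed rot_b] T_conj_a[OF b_closed rot_b] by (auto simp: T_b)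

lemma a_int_pow_eq: "[k = l] (mod int p) \<Longrightarrow> a [^] (k::int) = a [^] l"
  by (rule int_pow_mod_p[OF a_closed a_pow_p])

lemma a_int_pow_one: "int p dvd k \<Longrightarrow> a [^] (k::int) = \<one>"
  using a_int_pow_eq[of k 0] by (simp add: cong_0_iff)

lemma a_pow_commute: "a [^] (k::int) \<otimes> a [^] (l::int) = a [^] l \<otimes> a [^] k"
  by (simp add: int_pow_mult[symmetric] add.commute)

subsection \<open>Prescribing one section\<close>

lemma ex_exponent_sums: "x \<in> carrier G \<Longrightarrow> \<exists>i s. exponent_sums G a b i s x"
  using exponent_sums_generate[of x a b] generated_ab by simp

lemma rot_exponent_sums: "exponent_sums G a b i s x \<Longrightarrow> [rot x = i] (mod int p)"
proof (induction rule: exponent_sums.induct)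
  case (exponent_sums_mult i s v i' s' w)
  then show ?case using exponent_sums_closed a_closed b_closed
    by (blast intro: cong_trans[OF rot_mult] cong_add)
next
  case (exponent_sums_inv i s v)
  then have "[- rot v = - i] (mod int p)" by (simp add: cong_minus_minus_iff)
  then show ?case using exponent_sums_inv exponent_sums_closed a_closed b_closed
    by (blast intro: cong_trans[OF rot_inv])
qed (use rot_one rot_a rot_b in \<open>auto simp: cong_0_iff\<close>)

lemma exponent_sums_\<beta>: "exponent_sums G a b 0 1 (\<beta> m)"
proof -
  have pow: "exponent_sums G a b k 0 (a [^] k)" for k :: int
    using exponent_sums_int_pow[OF a_closed b_closed exponent_sums_fst, of k] by simp
  show ?thesis unfolding \<beta>_def
    using exponent_sums_mult[OF exponent_sums_mult[OF pow[of "- m"] exponent_sums_snd] pow[of m]]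
    by simp
qed

text \<open>Replace in a word every \<open>b\<close> by itself and every \<open>a\<close> by the \<open>r\<close>-th power of the conjugate of \<open>b\<close>
whose section at \<open>j\<close> is \<open>a\<^bsup>e u\<^esup>\<close>. The choice of \<open>u\<close> is kept free because it influences the exponent
sum of the new word.\<close>

lemma ex_lift:
  assumes "exponent_sums G a b i s x" and r: "[r * e u = 1] (mod int p)" and u: "\<not> int p dvd u"
  shows "\<exists>h. exponent_sums G a b 0 (s + i * r) h \<and> int p dvd rot h \<and> T h 0 = x"
  using assms(1)
proof (induction rule: exponent_sums.induct)
  case exponent_sums_one
  show ?case by (intro exI[of _ \<one>]) (auto intro: exponent_sums.intros simp: rot_one T_def)
next
  case exponent_sums_fst
  have "exponent_sums G a b (r * 0) (r * 1) (\<beta> (- u) [^] r)"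
    by (intro exponent_sums_int_pow exponent_sums_\<beta>) auto
  moreover have "T (\<beta> (- u) [^] r) 0 = a [^] (r * e u)"
    using u by (simp add: T_int_pow rot_\<beta> T_\<beta> int_pow_pow mult.commute)
  ultimately show ?case using a_int_pow_eq[OF r]
    by (intro exI[of _ "\<beta> (- u) [^] r"]) (simp add: rot_int_pow_fix rot_\<beta>)
next
  case exponent_sums_snd
  show ?case by (intro exI[of _ b]) (simp add: exponent_sums.exponent_sums_snd rot_b T_b)
next
  case (exponent_sums_mult i s v i' s' w)
  then obtain h h' where h: "exponent_sums G a b 0 (s + i * r) h" "int p dvd rot h" "T h 0 = v"
    and h': "exponent_sums G a b 0 (s' + i' * r) h'" "int p dvd rot h'" "T h' 0 = w" by blast
  have c: "h \<in> carrier G" "h' \<in> carrier G" using h h' exponent_sums_closed by blast+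
  show ?case using exponent_sums.exponent_sums_mult[OF h(1) h'(1)] h h' c
    by (intro exI[of _ "h \<otimes> h'"]) (simp add: rot_mult_fix T_mult algebra_simps)
next
  case (exponent_sums_inv i s v)
  then obtain h where h: "exponent_sums G a b 0 (s + i * r) h" "int p dvd rot h" "T h 0 = v" by blast
  have c: "h \<in> carrier G" using h exponent_sums_closed by blast
  show ?case using exponent_sums.exponent_sums_inv[OF h(1)] h c
    by (intro exI[of _ "inv h"]) (simp add: rot_inv_fix T_inv algebra_simps)
qed

lemma ex_section:
  assumes "x \<in> carrier G"
  shows "\<exists>h\<in>carrier G. int p dvd rot h \<and> T h 0 = x"
proof -
  obtain i s where "exponent_sums G a b i s x" using ex_exponent_sums assms by blast
  moreover have "[1 * e d = 1] (mod int p)" using e_d by simp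
  ultimately show ?thesis using ex_lift d_nonzero exponent_sums_closed by (metis a_closed b_closed)
qed

subsection \<open>The rigid normal subgroup\<close>

text \<open>The elements that occur at \<open>j\<close> in isolation: some element of the group acts by them below \<open>j\<close> and
trivially below the other letters.\<close>

definition rigid :: "'a set"
  where "rigid = {n. \<exists>k\<in>carrier G. int p dvd rot k \<and> T k 0 = n \<and>
    (\<forall>i. \<not> int p dvd i \<longrightarrow> T k i = \<one>)}"

lemma rigidI: "\<lbrakk>k \<in> carrier G; int p dvd rot k; \<And>i. \<not> int p dvd i \<Longrightarrow> T k i = \<one>\<rbrakk> \<Longrightarrow> T k 0 \<in> rigid"
  unfolding rigid_def by blast

text \<open>For normality, conjugation by \<open>x\<close> is realised by an element with section \<open>x\<close> at \<open>j\<close>.\<close>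

lemma normal_rigid: "rigid \<lhd> G"
proof -
  have "subgroup rigid G"
  proof
    show "rigid \<subseteq> carrier G" unfolding rigid_def by auto
    have "T \<one> 0 \<in> rigid" by (rule rigidI) (simp_all add: rot_one T_def)
    then show "\<one> \<in> rigid" by (simp add: T_def)
    show "x \<otimes> y \<in> rigid" if xy: "x \<in> rigid" "y \<in> rigid" for x y
    proof -
      obtain k l where kl: "k \<in> carrier G" "int p dvd rot k" "T k 0 = x" "\<And>i. \<not> int p dvd i \<Longrightarrow> T k i = \<one>"
        "l \<in> carrier G" "int p dvd rot l" "T l 0 = y" "\<And>i. \<not> int p dvd i \<Longrightarrow> T l i = \<one>"
        using xy unfolding rigid_def by blast
      have "T (k \<otimes> l) 0 \<in> rigid" using kl by (intro rigidI) (auto simp: T_mult rot_mult_fix)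
      then show ?thesis using kl by (simp add: T_mult)
    qed
    show "inv x \<in> rigid" if x: "x \<in> rigid" for x
    proof -
      obtain k where k: "k \<in> carrier G" "int p dvd rot k" "T k 0 = x" "\<And>i. \<not> int p dvd i \<Longrightarrow> T k i = \<one>"
        using x unfolding rigid_def by blast
      have "T (inv k) 0 \<in> rigid" using k by (intro rigidI) (auto simp: T_inv rot_inv_fix)
      then show ?thesis using k by (simp add: T_inv)
    qed
  qed
  moreover have "x \<otimes> n \<otimes> inv x \<in> rigid" if x: "x \<in> carrier G" and n: "n \<in> rigid" for x n
  proof -
    obtain k where k: "k \<in> carrier G" "int p dvd rot k" "T k 0 = n" "\<And>i. \<not> int p dvd i \<Longrightarrow> T k i = \<one>"
      using n unfolding rigid_def by blast
    obtain h where h: "h \<in> carrier G" "int p dvd rot h" "T h 0 = x" using ex_section[OF x] by blast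
    have T: "T (h \<otimes> k \<otimes> inv h) i = T h i \<otimes> T k i \<otimes> inv (T h i)" for i
      using h k by (simp add: T_mult T_inv rot_mult_fix)
    have "T (h \<otimes> k \<otimes> inv h) 0 \<in> rigid"
      using h k by (intro rigidI) (simp_all add: T rot_mult_fix rot_inv_fix)
    then show ?thesis using T h k by simp
  qed
  ultimately show ?thesis by (simp add: normal_inv_iff)
qed

abbreviation Q :: "'a set monoid"
  where "Q \<equiv> G Mod rigid"

definition \<phi> :: "'a \<Rightarrow> 'a set"
  where "\<phi> x = rigid #> x"

lemma group_Q: "group Q"
  using normal_rigid by (rule normal.factorgroup_is_group)

lemma group_hom_\<phi>: "group_hom G Q \<phi>"
proof -
  have "\<phi> = (#>) rigid" by (auto simp: \<phi>_def)
  then show ?thesis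
    using normal.r_coset_hom_Mod[OF normal_rigid] group_Q is_group
    by (simp add: group_hom_def group_hom_axioms_def)
qed

declare one_FactGroup [simp del] mult_FactGroup [simp del]

sublocale Q: group Q by (rule group_Q)
sublocale \<phi>: group_hom G Q \<phi> by (rule group_hom_\<phi>)

lemma \<phi>_eq_one: "x \<in> rigid \<Longrightarrow> \<phi> x = \<one>\<^bsub>Q\<^esub>"
  unfolding \<phi>_def using coset_join2[OF _ normal_imp_subgroup[OF normal_rigid]]
    subgroup.subset[OF normal_imp_subgroup[OF normal_rigid]] by (auto simp: FactGroup_def)

lemma \<phi>_eqD:
  assumes "x \<in> carrier G" "y \<in> carrier G" "\<phi> x = \<phi> y"
  shows "\<exists>n\<in>rigid. x = n \<otimes> y"
proof -
  have "x \<in> rigid #> y"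
    using assms rcos_self[OF assms(1) normal_imp_subgroup[OF normal_rigid]] unfolding \<phi>_def by simp
  then show ?thesis unfolding r_coset_def by auto
qed

definition commute_mod :: "'a \<Rightarrow> 'a \<Rightarrow> bool"
  where "commute_mod x y \<longleftrightarrow> \<phi> x \<otimes>\<^bsub>Q\<^esub> \<phi> y = \<phi> y \<otimes>\<^bsub>Q\<^esub> \<phi> x"

lemma commute_mod_sym: "commute_mod x y \<Longrightarrow> commute_mod y x"
  unfolding commute_mod_def by simp

lemma commute_mod_self: "commute_mod x x"
  unfolding commute_mod_def ..

lemma commute_mod_mult:
  "\<lbrakk>x \<in> carrier G; y \<in> carrier G; z \<in> carrier G; commute_mod x y; commute_mod x z\<rbrakk>
    \<Longrightarrow> commute_mod x (y \<otimes> z)"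
  unfolding commute_mod_def \<phi>.hom_mult by (intro Q.commute_mult \<phi>.hom_closed)

lemma commute_mod_int_pow:
  "\<lbrakk>x \<in> carrier G; y \<in> carrier G; commute_mod x y\<rbrakk> \<Longrightarrow> commute_mod x (y [^] (k::int))"
  unfolding commute_mod_def using Q.commute_int_pow[of "\<phi> x" "\<phi> y" k]
  by (simp add: \<phi>.hom_int_pow \<phi>.hom_closed)

lemma commute_mod_root:
  assumes x: "x \<in> carrier G" and y: "y \<in> carrier G" and yp: "y [^] p = \<one>"
    and k: "\<not> int p dvd k" and c: "commute_mod x (y [^] (k::int))"
  shows "commute_mod x y"
proof -
  have "coprime k (int p)" using prime_int_p k prime_imp_coprime coprime_commute by blast
  then obtain r where "[k * r = 1] (mod int p)" using cong_solve_coprime_int by blast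
  then have "(y [^] k) [^] r = y"
    using int_pow_mod_p[OF y yp, of "k * r" 1] y by (simp add: int_pow_pow)
  then show ?thesis using commute_mod_int_pow[OF x _ c, of r] y by simp
qed

definition comm :: "'a \<Rightarrow> 'a \<Rightarrow> 'a"
  where "comm x y = inv x \<otimes> inv y \<otimes> (x \<otimes> y)"

lemma comm_closed [simp]: "\<lbrakk>x \<in> carrier G; y \<in> carrier G\<rbrakk> \<Longrightarrow> comm x y \<in> carrier G"
  unfolding comm_def by simp

lemma swap_comm: "\<lbrakk>x \<in> carrier G; y \<in> carrier G\<rbrakk> \<Longrightarrow> x \<otimes> y = y \<otimes> x \<otimes> comm x y"
  unfolding comm_def by (simp add: m_assoc)

lemma comm_eq_one: "\<lbrakk>x \<in> carrier G; y \<in> carrier G; x \<otimes> y = y \<otimes> x\<rbrakk> \<Longrightarrow> comm x y = \<one>"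
  unfolding comm_def by (simp add: m_assoc)

lemma commute_mod_comm: "\<lbrakk>x \<in> carrier G; y \<in> carrier G; comm x y \<in> rigid\<rbrakk> \<Longrightarrow> commute_mod x y"
  unfolding commute_mod_def using arg_cong[OF swap_comm[of x y], of \<phi>] \<phi>_eq_one[of "comm x y"]
  by (simp add: \<phi>.hom_mult)

lemma rot_comm: "\<lbrakk>x \<in> carrier G; y \<in> carrier G; int p dvd rot x; int p dvd rot y\<rbrakk>
  \<Longrightarrow> int p dvd rot (comm x y)"
  unfolding comm_def by (simp add: rot_mult_fix rot_inv_fix)

lemma T_comm: "\<lbrakk>x \<in> carrier G; y \<in> carrier G; int p dvd rot x; int p dvd rot y\<rbrakk>
  \<Longrightarrow> T (comm x y) i = comm (T x i) (T y i)"
  unfolding comm_def by (simp add: rot_mult_fix rot_inv_fix T_mult T_inv)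

text \<open>The source of elements of \<open>rigid\<close>: the commutator of two elements whose sections commute at all letters
but \<open>j\<close> is trivial there.\<close>

lemma commute_mod_sections:
  assumes "x \<in> carrier G" "y \<in> carrier G" "int p dvd rot x" "int p dvd rot y"
    and "\<And>i. \<not> int p dvd i \<Longrightarrow> T x i \<otimes> T y i = T y i \<otimes> T x i"
  shows "commute_mod (T x 0) (T y 0)"
proof -
  have "T (comm x y) 0 \<in> rigid"
    using assms by (intro rigidI) (simp_all add: rot_comm T_comm comm_eq_one)
  then show ?thesis using assms by (intro commute_mod_comm) (simp_all add: T_comm)
qed

text \<open>The case in which the entries \<open>e d, e (2 d), \<dots>\<close> form a geometric progression of ratio \<open>l\<close>. Then
\<open>\<beta> 0 \<otimes> (\<beta> d)\<^bsup>-l\<^esup>\<close> is trivial outside the two positions \<open>0\<close> and \<open>d\<close>, so it meets its shift by \<open>- d\<close> in one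
letter only. The resulting relation says that \<open>b a\<^sup>-\<^sup>1\<close> and \<open>a b\<^bsup>-l\<^esup>\<close> commute modulo \<open>rigid\<close>; as their
product is \<open>b\<^bsup>1 - l\<^esup>\<close> with \<open>l \<noteq> 1\<close>, so do \<open>a\<close> and \<open>b\<close>.\<close>

lemma commute_mod_ab_geometric:
  assumes geo: "\<And>u. \<lbrakk>\<not> int p dvd u; \<not> int p dvd u + d\<rbrakk> \<Longrightarrow> [e (u + d) = l * e u] (mod int p)"
  shows "commute_mod a b"
proof -
  have d2: "\<not> int p dvd d + d" using two_d_nonzero by simp
  \<comment> \<open>Sum the relation \<open>e (u + d) = l * e u\<close> over all \<open>u\<close>. Both sides have total \<open>0\<close>, and the relation
    fails only for \<open>u = 0\<close> and \<open>u = - d\<close>, with defects \<open>e d = 1\<close> and \<open>- l * e (- d)\<close>.\<close>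
  have w: "[l * e (- d) = 1] (mod int p)"
  proof -
    let ?f = "\<lambda>u. e (u + d) - l * e u"
    let ?m = "(- d) mod int p"
    have m: "?m \<in> {0..<int p}" "?m \<noteq> 0" using p_gt_0 d_nonzero by (auto simp: dvd_eq_mod_eq_0[symmetric])
    have "[?f u = (if u = 0 then 1 else 0) + (if u = ?m then - l * e (- d) else 0)] (mod int p)"
      if u: "u \<in> {0..<int p}" for u
    proof -
      consider "u = 0" | "u = ?m" "u \<noteq> 0" | "u \<noteq> 0" "u \<noteq> ?m" by blast
      then show ?thesis
      proof cases
        case 1
        have "[e d - l * e 0 = 1 - l * 0] (mod int p)"
          using e_d e_zero[of 0] by (intro cong_diff cong_scalar_left) (auto simp: cong_0_iff)
        then show ?thesis using 1 m by simp
      next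
        case 2
        have "int p dvd u + d" using 2 by (simp add: dvd_eq_mod_eq_0 mod_simps)
        moreover have "e u = e (- d)" using 2 by (intro e_cong) (simp add: cong_def)
        ultimately show ?thesis using 2 e_zero[of "u + d"] by (simp add: cong_iff_dvd_diff)
      next
        case 3
        have "\<not> int p dvd u" using 3 u zdvd_not_zless by fastforce
        moreover have "\<not> int p dvd u + d"
        proof
          assume "int p dvd u + d"
          then have "[u = - d] (mod int p)" by (simp add: cong_iff_dvd_diff)
          then show False using 3 u by (simp add: cong_def)
        qed
        ultimately show ?thesis using 3 geo[of u] by (simp add: cong_iff_dvd_diff)
      qed
    qed
    then have "[(\<Sum>u\<in>{0..<int p}. ?f u) = (\<Sum>u\<in>{0..<int p}.
        (if u = 0 then 1 else 0) + (if u = ?m then - l * e (- d) else 0))] (mod int p)"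
      by (rule cong_sum)
    also have "(\<Sum>u\<in>{0..<int p}. (if u = 0 then 1 else 0) + (if u = ?m then - l * e (- d) else 0))
        = 1 - l * e (- d)"
      using m p_gt_0 by (simp add: sum.distrib)
    finally have "[(\<Sum>u\<in>{0..<int p}. ?f u) = 1 - l * e (- d)] (mod int p)" .
    moreover have "(\<Sum>u\<in>{0..<int p}. ?f u) = (\<Sum>u\<in>{0..<int p}. e u) - l * (\<Sum>u\<in>{0..<int p}. e u)"
      using sum_shift_mod[where f = e and c = d, OF prime_p e_cong] by (simp add: sum_subtractf sum_distrib_left)
    ultimately have "int p dvd 1 - l * e (- d)" using e_sum by (simp add: cong_dvd_iff[symmetric])
    then show ?thesis by (simp add: cong_iff_dvd_diff dvd_diff_commute)
  qed
  \<comment> \<open>For ratio \<open>1\<close> all entries would be equal to \<open>1\<close>, apart from \<open>e 0\<close>.\<close>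
  have l1: "\<not> int p dvd 1 - l"
  proof
    assume l: "int p dvd 1 - l"
    have pos: "[e (int (Suc k) * d) = 1] (mod int p)" if "Suc k < p" for k
      using that
    proof (induction k)
      case 0
      then show ?case using e_d by simp
    next
      case (Suc k)
      have nz: "\<not> int p dvd int m * d" if "0 < m" "m < p" for m
        using that d_nonzero prime_dvd_multD[OF prime_int_p] zdvd_not_zless[of "int m" "int p"] by fastforce
      have "[e (int (Suc k) * d + d) = l * e (int (Suc k) * d)] (mod int p)"
        using nz[of "Suc k"] nz[of "Suc (Suc k)"] Suc.prems by (intro geo) (simp_all add: algebra_simps)
      also have "[l * e (int (Suc k) * d) = 1 * 1] (mod int p)"
        using Suc l by (intro cong_mult) (auto simp: cong_iff_dvd_diff dvd_diff_commute)
      finally show ?case by (simp add: algebra_simps)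
    qed
    obtain u where u: "\<not> int p dvd e u" "\<not> [e u = 1] (mod int p)" using ex_other_exponent by blast
    have "coprime d (int p)" using prime_int_p d_nonzero prime_imp_coprime coprime_commute by blast
    then obtain r where "[d * r = 1] (mod int p)" using cong_solve_coprime_int by blast
    then have "[d * r * u = 1 * u] (mod int p)" by (rule cong_scalar_right)
    then have eq: "[(r * u) mod int p * d = u] (mod int p)"
      unfolding cong_def mod_mult_left_eq by (simp add: mult_ac)
    define k where "k = nat ((r * u) mod int p)"
    have k: "int k = (r * u) mod int p" "k < p"
      unfolding k_def using p_gt_0 by (auto simp: nat_less_iff)
    have "e (int k * d) = e u" using e_cong eq k by simp
    moreover have "k \<noteq> 0"
    proof
      assume "k = 0"
      then have "[u = 0] (mod int p)" using eq k(1) by (metis cong_sym mult_zero_left of_nat_0)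
      then show False using u(1) e_zero by (simp add: cong_0_iff)
    qed
    ultimately show False using pos[of "k - 1"] u k by simp
  qed
  define z where "z = \<beta> 0 \<otimes> \<beta> d [^] (- l)"
  have z: "z \<in> carrier G" "int p dvd rot z" 
    unfolding z_def by (simp_all add: rot_mult_fix rot_int_pow_fix rot_\<beta>)
  have Tz: "T z i = T (\<beta> 0) i \<otimes> T (\<beta> d) i [^] (- l)" for i
    unfolding z_def by (simp add: T_mult T_int_pow rot_\<beta>)
  have "b \<otimes> (a [^] e (- d)) [^] (- l) = b \<otimes> a [^] (- 1::int)"
    using w by (subst int_pow_pow) (auto intro!: arg_cong2[where f = "(\<otimes>)"] a_int_pow_eq
        simp: cong_iff_dvd_diff algebra_simps dvd_diff_commute)
  then have z0: "T z 0 = b \<otimes> inv a" using d_nonzero Tz by (simp add: T_\<beta> int_pow_neg)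
  have zd: "T z d = a \<otimes> b [^] (- l)"
    using d_nonzero Tz a_int_pow_eq[OF e_d] by (simp add: T_\<beta>)
  have zi: "T z i = \<one>" if "\<not> int p dvd i" "\<not> int p dvd i - d" for i
    using that Tz geo[of "i - d"]
    by (simp add: T_\<beta> int_pow_pow int_pow_mult[symmetric] a_int_pow_one cong_iff_dvd_diff algebra_simps)
  define z' where "z' = a [^] (- (- d)) \<otimes> z \<otimes> a [^] (- d)"
  have z': "z' \<in> carrier G" "int p dvd rot z'" "\<And>i. T z' i = T z (i + d)"
    unfolding z'_def using z rot_conj_a[OF z, of "- d"] T_conj_a[OF z, of "- d"] by auto
  have "commute_mod (T z 0) (T z' 0)"
  proof (rule commute_mod_sections[OF z(1) z'(1) z(2) z'(2)])
    fix i assume i: "\<not> int p dvd i"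
    show "T z i \<otimes> T z' i = T z' i \<otimes> T z i"
    proof (cases "int p dvd i - d")
      case True
      have "\<not> int p dvd i + d"
        using True d2 dvd_add_right_iff[OF True, of "d + d"] by (simp add: algebra_simps)
      then have "T z' i = \<one>" using z'(3) zi[of "i + d"] i by simp
      then show ?thesis using z by simp
    next
      case False
      then show ?thesis using zi[OF i False] T_closed[OF z'(1), of i] by simp
    qed
  qed
  then have c: "commute_mod (b \<otimes> inv a) (a \<otimes> b [^] (- l))" using z0 zd z'(3)[of 0] by simp
  have "commute_mod (b \<otimes> inv a) ((b \<otimes> inv a) \<otimes> (a \<otimes> b [^] (- l)))"
    by (rule commute_mod_mult[OF _ _ _ commute_mod_self c]) auto
  also have "(b \<otimes> inv a) \<otimes> (a \<otimes> b [^] (- l)) = b [^] (1 - l)"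
    using int_pow_mult[of b 1 "- l"] by (simp add: m_assoc)
  finally have "commute_mod (b \<otimes> inv a) b"
    by (intro commute_mod_root[OF _ _ b_pow_p l1]) auto
  then have bY: "commute_mod b (b \<otimes> inv a)" by (rule commute_mod_sym)
  have "b [^] (-1::int) \<otimes> (b \<otimes> inv a) = inv a"
    using int_pow_neg[OF b_closed, of 1] by simp
  then have ba: "commute_mod b (inv a)"
    using commute_mod_mult[OF b_closed _ _ commute_mod_int_pow[OF b_closed b_closed commute_mod_self, of "-1"] bY]
    by simp
  have "inv a [^] (-1::int) = a" using int_pow_neg[of "inv a" 1] by simp
  then show ?thesis
    using commute_mod_sym[OF commute_mod_int_pow[OF b_closed _ ba, of "-1"]] by simp
qed

text \<open>The commutator \<open>k\<close> of \<open>\<beta> 0\<close> and \<open>\<beta> (- d)\<close> has the section \<open>[b, a]\<close> at \<open>0\<close>, some other section at \<open>- d\<close>, and is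
trivial elsewhere. Hence \<open>[b, a]\<close> commutes modulo \<open>rigid\<close> with the section at \<open>0\<close> of every
element \<open>z\<close> that is trivial at \<open>- d\<close>. Such \<open>z\<close> are produced by multiplying with a power of
\<open>\<beta> (- 2 * d)\<close>, whose section at \<open>- d\<close> is \<open>a\<close>. Starting from \<open>\<beta> 0\<close> this yields \<open>b\<close> times a power of
\<open>a\<close> at \<open>0\<close>, and starting from \<open>\<beta> (- d - u)\<close> a power of \<open>a\<close>, nontrivial precisely when \<open>u\<close>
violates the geometric relation with ratio \<open>e (2 * d)\<close>. When there is no such \<open>u\<close> the commutator itself
is in \<open>rigid\<close>.\<close>

lemma comm_central_mod: "commute_mod (comm b a) a \<and> commute_mod (comm b a) b"
proof (cases "\<forall>u. \<not> int p dvd u \<longrightarrow> \<not> int p dvd u + d \<longrightarrow> [e (u + d) = e (2 * d) * e u] (mod int p)")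
  case True
  then have ab: "commute_mod a b" using commute_mod_ab_geometric by blast
  have "\<phi> (comm b a) = \<one>\<^bsub>Q\<^esub>"
  proof -
    have "\<phi> (b \<otimes> a) = \<phi> (a \<otimes> b) \<otimes>\<^bsub>Q\<^esub> \<phi> (comm b a)"
      using swap_comm[of b a] by (metis \<phi>.hom_mult a_closed b_closed comm_closed m_closed)
    moreover have "\<phi> (b \<otimes> a) = \<phi> (a \<otimes> b)" using ab unfolding commute_mod_def by simp
    ultimately show ?thesis
      using Q.l_cancel_one'[of "\<phi> (a \<otimes> b)" "\<phi> (comm b a)"]
      by (simp only: \<phi>.hom_closed a_closed b_closed comm_closed m_closed)
  qed
  then show ?thesis unfolding commute_mod_def by simp
next
  case False
  then obtain u where u: "\<not> int p dvd u" "\<not> int p dvd u + d"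
    and ne: "\<not> [e (u + d) = e (2 * d) * e u] (mod int p)" by blast
  define k where "k = comm (\<beta> 0) (\<beta> (- d))"
  have k: "k \<in> carrier G" "int p dvd rot k" unfolding k_def by (simp_all add: rot_comm rot_\<beta>)
  have Tk: "T k i = comm (T (\<beta> 0) i) (T (\<beta> (- d)) i)" for i
    unfolding k_def by (simp add: T_comm rot_\<beta>)
  have k0: "T k 0 = comm b a" using d_nonzero a_int_pow_eq[OF e_d] by (simp add: Tk T_\<beta>)
  have ki: "T k i = \<one>" if "\<not> int p dvd i" "\<not> int p dvd i + d" for i
    using that by (simp add: Tk T_\<beta> comm_eq_one a_pow_commute)
  have main: "commute_mod (comm b a) (T z 0)"
    if z: "z \<in> carrier G" "int p dvd rot z" and zd: "T z (- d) = \<one>" for z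
    unfolding k0[symmetric]
  proof (rule commute_mod_sections[OF k(1) z(1) k(2) z(2)])
    fix i assume i: "\<not> int p dvd i"
    show "T k i \<otimes> T z i = T z i \<otimes> T k i"
    proof (cases "int p dvd i + d")
      case True
      then have "T z i = \<one>" using T_cong[OF z(1), of i "- d"] zd by simp
      then show ?thesis using k by simp
    next
      case False
      then show ?thesis using ki[OF i False] z by simp
    qed
  qed
  have c: "comm b a \<in> carrier G" by simp
  have d2: "\<not> int p dvd 2 * d" by (rule two_d_nonzero)
  let ?f = "\<lambda>x m. x \<otimes> \<beta> (- 2 * d) [^] (- m)"
  have f0: "T (?f x m) 0 = T x 0 \<otimes> a [^] (- (e (2 * d) * m))"
    if "x \<in> carrier G" "int p dvd rot x" for x and m :: int
    using that d2 by (simp add: T_mult T_int_pow rot_\<beta> T_\<beta> int_pow_pow)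
  have fd: "T (?f x m) (- d) = T x (- d) \<otimes> a [^] (- m)"
    if "x \<in> carrier G" "int p dvd rot x" for x and m :: int
    using that d_nonzero a_int_pow_eq[OF e_d]
    by (simp add: T_mult T_int_pow rot_\<beta> T_\<beta>)
  have fr: "?f x m \<in> carrier G" "int p dvd rot (?f x m)"
    if "x \<in> carrier G" "int p dvd rot x" for x and m :: int
    using that by (simp_all add: rot_mult_fix rot_int_pow_fix rot_\<beta>)
  have A: "commute_mod (comm b a) a"
  proof -
    let ?z = "?f (\<beta> (- d - u)) (e u)"
    have "T ?z (- d) = \<one>"
      using u by (subst fd) (simp_all add: rot_\<beta> T_\<beta> int_pow_mult[symmetric])
    then have "commute_mod (comm b a) (T ?z 0)" by (intro main fr) (auto simp: rot_\<beta>)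
    moreover have "T ?z 0 = a [^] (e (u + d) - e (2 * d) * e u)"
      using u by (subst f0) (simp_all add: rot_\<beta> T_\<beta> int_pow_mult[symmetric] algebra_simps)
    ultimately show ?thesis
      using commute_mod_root[OF c a_closed a_pow_p] ne by (simp add: cong_iff_dvd_diff)
  qed
  have B: "commute_mod (comm b a) b"
  proof -
    let ?z = "?f (\<beta> 0) (e (- d))"
    have "T ?z (- d) = \<one>"
      using d_nonzero by (subst fd) (simp_all add: rot_\<beta> T_\<beta> int_pow_mult[symmetric])
    then have "commute_mod (comm b a) (T ?z 0)" by (intro main fr) (auto simp: rot_\<beta>)
    moreover have "T ?z 0 = b \<otimes> a [^] (- (e (2 * d) * e (- d)))"
      by (subst f0) (simp_all add: rot_\<beta> T_\<beta>)
    ultimately have "commute_mod (comm b a) (b \<otimes> a [^] (- (e (2 * d) * e (- d))) \<otimes> a [^] (e (2 * d) * e (- d)))"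
      using commute_mod_mult[OF c _ _ _ commute_mod_int_pow[OF c a_closed A]] by simp
    then show ?thesis by (simp add: m_assoc int_pow_mult[symmetric])
  qed
  show ?thesis using A B by blast
qed

subsection \<open>The order grows by a factor \<open>p\<close> every two levels\<close>

lemma exponent_sums_\<phi>:
  "exponent_sums G a b i s x \<Longrightarrow> exponent_sums Q (\<phi> a) (\<phi> b) i s (\<phi> x)"
proof (induction rule: exponent_sums.induct)
  case (exponent_sums_mult i s v i' s' w)
  then show ?case
    using exponent_sums.exponent_sums_mult exponent_sums_closed[OF exponent_sums_mult.hyps(1)]
      exponent_sums_closed[OF exponent_sums_mult.hyps(2)] by (metis \<phi>.hom_mult a_closed b_closed)
next
  case (exponent_sums_inv i s v)
  then show ?case
    using exponent_sums.exponent_sums_inv exponent_sums_closed[OF exponent_sums_inv.hyps]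
    by (metis \<phi>.hom_inv a_closed b_closed)
next
  case exponent_sums_one
  then show ?case using exponent_sums.exponent_sums_one[of Q "\<phi> a" "\<phi> b"] by (simp only: \<phi>.hom_one)
qed (rule exponent_sums.intros)+

text \<open>Lifting \<open>x\<close> by means of the entry \<open>e d = 1\<close> gives the exponent sum \<open>s + i\<close>. If this vanishes, an
entry other than \<open>0\<close> and \<open>1\<close> changes \<open>i\<close> into another multiple of \<open>i\<close>.\<close>

lemma ex_nonzero_lift:
  assumes x: "x \<in> carrier G" and nr: "\<not> int p dvd rot x"
  shows "\<exists>h S. exponent_sums G a b 0 S h \<and> \<not> int p dvd S \<and> int p dvd rot h \<and> T h 0 = x"
proof -
  obtain i s where ex: "exponent_sums G a b i s x" using ex_exponent_sums[OF x] by blast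
  then have i: "\<not> int p dvd i" using nr rot_exponent_sums by (meson cong_dvd_iff)
  show ?thesis
  proof (cases "int p dvd s + i * 1")
    case False
    then show ?thesis using ex_lift[OF ex, of 1 d] e_d d_nonzero by auto
  next
    case True
    obtain u where u: "\<not> int p dvd e u" "\<not> [e u = 1] (mod int p)" using ex_other_exponent by blast
    have "coprime (e u) (int p)" using prime_int_p u(1) prime_imp_coprime coprime_commute by blast
    then obtain r where r: "[r * e u = 1] (mod int p)"
      using cong_solve_coprime_int by (metis mult.commute)
    have "\<not> int p dvd r - 1"
    proof
      assume "int p dvd r - 1"
      then have "[r * e u = 1 * e u] (mod int p)"
        by (intro cong_scalar_right) (simp add: cong_iff_dvd_diff)
      then show False using u(2) r by (metis cong_sym cong_trans mult_1)
    qed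
    then have "\<not> int p dvd i * (r - 1)" using i prime_dvd_multD[OF prime_int_p] by blast
    moreover have "s + i * r = (s + i * 1) + i * (r - 1)" by (simp add: algebra_simps)
    ultimately have "\<not> int p dvd s + i * r" using True by (metis dvd_add_right_iff)
    moreover have "\<not> int p dvd u" using u(1) e_zero by blast
    ultimately show ?thesis using ex_lift[OF ex r] by blast
  qed
qed

text \<open>Take a lift \<open>h\<close> of \<open>x\<close> with nonzero exponent sum \<open>S\<close>. Modulo \<open>rigid\<close> a conjugate \<open>h'\<close> of \<open>h\<close> by a power
of \<open>a\<close> equals \<open>b\<^sup>S\<close>, say \<open>h' = n \<otimes> b\<^sup>S\<close>, and \<open>x\<close> is still one of its sections. With \<open>v\<close> acting as
\<open>n\<close> below \<open>j\<close> only, the element \<open>y = v \<otimes> b\<^sup>S \<otimes> a\<close> has the section \<open>h'\<close> at \<open>j\<close> and powers of \<open>a\<close> with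
exponent sum zero elsewhere. So the section of \<open>y\<^sup>p\<close> at \<open>j\<close> is exactly \<open>h'\<close>.\<close>

lemma ex_double_section_of_pow_p:
  assumes x: "x \<in> carrier G" and nr: "\<not> int p dvd rot x"
  shows "\<exists>y\<in>carrier G. \<not> int p dvd rot y \<and>
    (\<exists>i i'. int p dvd rot (sec (y [^] p) i) \<and> sec (sec (y [^] p) i) i' = x)"
proof -
  obtain h S where hS: "exponent_sums G a b 0 S h" "\<not> int p dvd S" "int p dvd rot h" "T h 0 = x"
    using ex_nonzero_lift[OF x nr] by blast
  have h: "h \<in> carrier G" using hS(1) exponent_sums_closed by blast
  have "\<phi> b \<otimes>\<^bsub>Q\<^esub> \<phi> a = \<phi> a \<otimes>\<^bsub>Q\<^esub> \<phi> b \<otimes>\<^bsub>Q\<^esub> \<phi> (comm b a)"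
    using swap_comm[of b a] by (metis \<phi>.hom_mult a_closed b_closed comm_closed m_closed)
  moreover have "\<phi> a [^]\<^bsub>Q\<^esub> p = \<one>\<^bsub>Q\<^esub>"
    using \<phi>.hom_nat_pow[of a p] a_pow_p by simp
  ultimately obtain t :: int where t: "\<phi> h =
      inv\<^bsub>Q\<^esub> (\<phi> a [^]\<^bsub>Q\<^esub> t) \<otimes>\<^bsub>Q\<^esub> \<phi> b [^]\<^bsub>Q\<^esub> S \<otimes>\<^bsub>Q\<^esub> \<phi> a [^]\<^bsub>Q\<^esub> t"
    using Q.conj_to_power_class_two[of "\<phi> a" "\<phi> b" "\<phi> (comm b a)" S "\<phi> h" p]
      exponent_sums_\<phi>[OF hS(1)] comm_central_mod prime_p hS(2)
    unfolding commute_mod_def by (auto simp: \<phi>.hom_closed)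
  define h' where "h' = a [^] (- (- t)) \<otimes> h \<otimes> a [^] (- t)"
  have h': "h' \<in> carrier G" "int p dvd rot h'" "T h' (- t) = x"
    unfolding h'_def using h rot_conj_a[OF h hS(3), of "- t"] T_conj_a[OF h hS(3), of "- t" "- t"] hS(4)
    by auto
  have "\<phi> h' = \<phi> (b [^] S)"
    unfolding h'_def using h t
    by (simp add: \<phi>.hom_int_pow int_pow_neg Q.m_assoc \<phi>.hom_closed)
  then obtain n where n: "n \<in> rigid" "h' = n \<otimes> b [^] S"
    using \<phi>_eqD[OF h'(1)] by (metis b_closed int_pow_closed)
  then obtain v where v: "v \<in> carrier G" "int p dvd rot v" "T v 0 = n" "\<And>i. \<not> int p dvd i \<Longrightarrow> T v i = \<one>"
    unfolding rigid_def by blast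
  define y where "y = v \<otimes> b [^] S \<otimes> a"
  have y: "y \<in> carrier G" unfolding y_def using v by simp
  have vb: "int p dvd rot (v \<otimes> b [^] S)" using v rot_b by (simp add: rot_mult_fix rot_int_pow_fix)
  have "[rot y = rot (v \<otimes> b [^] S) + rot a] (mod int p)"
    unfolding y_def using v by (intro rot_mult) auto
  also have "[rot (v \<otimes> b [^] S) + rot a = 0 + 1] (mod int p)"
    using vb by (intro cong_add rot_a) (simp add: cong_0_iff)
  finally have "[rot y = 0 + 1] (mod int p)" .
  then have ny: "\<not> int p dvd rot y" using p_gt_1 by (simp add: cong_dvd_iff)
  have Ty: "T y i = T v i \<otimes> T b i [^] S" for i
  proof -
    have "T y i = T (v \<otimes> b [^] S) i \<otimes> T a i" unfolding y_def using v vb by (intro T_mult) auto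
    moreover have "T a i = \<one>" by (simp add: T_def sec_a)
    moreover have "T (v \<otimes> b [^] S) i = T v i \<otimes> T b i [^] S"
      using v rot_b by (simp add: T_mult T_int_pow)
    ultimately show ?thesis using v by simp
  qed
  let ?v = "\<lambda>i. if int p dvd i - j then 0 else rot (sec b i) * S"
  have "sec (y [^] p) j = sec y j \<otimes> a [^] (\<Sum>i\<in>{0..<int p}. ?v i)"
  proof (rule sec_pow_p_single[OF y ny])
    fix i assume i: "\<not> int p dvd i - j"
    show "sec y i = a [^] ?v i"
    proof -
      have "sec b i [^] S = a [^] (rot (sec b i) * S)"
        by (subst directedD(5)[OF directed_b i]) (rule int_pow_pow[OF a_closed])
      then show ?thesis using Ty[of "i - j"] v(4)[OF i] i by (simp add: T_def)
    qed
  next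
    fix i i' assume c: "[i = i'] (mod int p)"
    have "int p dvd i - j \<longleftrightarrow> int p dvd i' - j"
      using c by (intro cong_dvd_iff cong_diff) auto
    then show "?v i = ?v i'" using rot_sec_cong[OF b_closed c] by simp
  qed simp
  moreover have "int p dvd (\<Sum>i\<in>{0..<int p}. ?v i)"
  proof -
    have "[?v i = rot (sec b i) * S] (mod int p)" for i
      using rot_b directedD(3)[OF directed_b, of i]
      by (cases "int p dvd i - j") (simp_all add: cong_0_iff cong_sym_eq[of 0])
    then have "[(\<Sum>i\<in>{0..<int p}. ?v i) = (\<Sum>i\<in>{0..<int p}. rot (sec b i) * S)] (mod int p)"
      by (rule cong_sum)
    also have "(\<Sum>i\<in>{0..<int p}. rot (sec b i) * S) = rot_sum b * S"
      unfolding rot_sum_def by (simp add: sum_distrib_right)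
    finally show ?thesis using rot_sum_b by (simp add: cong_dvd_iff)
  qed
  ultimately have "sec (y [^] p) j = sec y j" using y by (simp add: a_int_pow_one)
  also have "sec y j = h'" using Ty[of 0] v n by (simp add: T_b) (simp add: T_def)
  finally have "sec (y [^] p) j = h'" .
  then show ?thesis using y ny h' unfolding T_def by blast
qed

theorem ex_pow_not_fixes_level:
  "\<exists>x\<in>carrier G. \<not> int p dvd rot x \<and> \<not> St (2 * m + 1) (x [^] (p ^ m))"
proof (induction m)
  case 0
  have "\<not> int p dvd rot a" using rot_a p_gt_1 by (simp add: cong_dvd_iff)
  then show ?case by (intro bexI[of _ a]) auto
next
  case (Suc m)
  then obtain x where x: "x \<in> carrier G" "\<not> int p dvd rot x" "\<not> St (2 * m + 1) (x [^] (p ^ m))" by blast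
  obtain y i i' where y: "y \<in> carrier G" "\<not> int p dvd rot y"
    and r: "int p dvd rot (sec (y [^] p) i)" and sec: "sec (sec (y [^] p) i) i' = x"
    using ex_double_section_of_pow_p[OF x(1,2)] by blast
  have "\<not> St (2 * Suc m + 1) (y [^] (p ^ Suc m))"
  proof
    assume "St (2 * Suc m + 1) (y [^] (p ^ Suc m))"
    moreover have "2 * Suc m + 1 = Suc (Suc (2 * m + 1))" by simp
    ultimately have "St (2 * m + 1) (sec (sec (y [^] (p ^ Suc m)) i) i')"
      by (metis fixes_level.simps(2))
    moreover have "y [^] (p ^ Suc m) = (y [^] p) [^] (p ^ m)" using y by (simp add: nat_pow_pow)
    ultimately show False
      using x(3) y r sec by (simp add: sec_pow_fix rot_pow_p del: fixes_level.simps)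
  qed
  then show ?case using y by blast
qed

end

section \<open>The exponent of a congruence quotient\<close>

context cyclic_self_similar
begin

definition level_kernel :: "nat \<Rightarrow> 'a set"
  where "level_kernel n = {x \<in> carrier G. St n x}"

lemma normal_level_kernel: "level_kernel n \<lhd> G"
proof -
  have "subgroup (level_kernel n) G"
    by unfold_locales (auto simp: level_kernel_def St_mult St_inv)
  then show ?thesis by (simp add: normal_inv_iff level_kernel_def St_conj)
qed

lemma level_quotient_pow_eq_one:
  assumes x: "x \<in> carrier G"
  shows "(level_kernel n #> x) [^]\<^bsub>G Mod level_kernel n\<^esub> (m::nat) = \<one>\<^bsub>G Mod level_kernel n\<^esub>
    \<longleftrightarrow> St n (x [^] m)"
proof -
  have mem: "x [^] m \<in> level_kernel n \<longleftrightarrow> St n (x [^] m)" using x by (simp add: level_kernel_def)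
  interpret N: normal "level_kernel n" G by (rule normal_level_kernel)
  have "level_kernel n #> x [^] m = level_kernel n \<longleftrightarrow> x [^] m \<in> level_kernel n"
    by (rule iffI[OF coset_join1[OF _ nat_pow_closed[OF x] N.subgroup_axioms]
        coset_join2[OF nat_pow_closed[OF x] N.subgroup_axioms]])
  then show ?thesis unfolding mem N.FactGroup_pow[OF x] one_FactGroup by blast
qed

text \<open>In the quotient by the level stabilizer the order of \<open>x\<close> is a power of \<open>p\<close> that does not divide
\<open>p\<^sup>k\<close>.\<close>

lemma prime_power_dvd_if_fixes_level:
  assumes x: "x \<in> carrier G" and m: "St n (x [^] m)" and k: "\<not> St n (x [^] (p ^ k))"
  shows "p ^ Suc k dvd m"
proof -
  interpret N: normal "level_kernel n" G by (rule normal_level_kernel)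
  let ?Q = "G Mod level_kernel n" and ?y = "level_kernel n #> x"
  interpret Q: group ?Q by (rule N.factorgroup_is_group)
  have y: "?y \<in> carrier ?Q" using x by (auto simp: carrier_FactGroup)
  have ord: "St n (x [^] l) \<longleftrightarrow> Q.ord ?y dvd l" for l :: nat
    using level_quotient_pow_eq_one[OF x] Q.pow_eq_id[OF y] by blast
  have "Q.ord ?y dvd p ^ n" using pow_fixes_level[OF x] ord by blast
  then obtain i where i: "Q.ord ?y = p ^ i" using divides_primepow_nat[OF prime_p] by blast
  have "\<not> i \<le> k" using k ord i by (metis le_imp_power_dvd)
  then have "p ^ Suc k dvd Q.ord ?y" unfolding i by (intro le_imp_power_dvd) simp
  then show ?thesis using m ord dvd_trans by blast
qed

lemma group_exponent_level_quotient:
  assumes all: "\<And>x. x \<in> carrier G \<Longrightarrow> St n (x [^] (p ^ Suc k))"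
    and x: "x \<in> carrier G" "\<not> St n (x [^] (p ^ k))"
  shows "group_exponent (G Mod level_kernel n) = p ^ Suc k"
  unfolding group_exponent_def
proof (rule Least_equality)
  have "y [^]\<^bsub>G Mod level_kernel n\<^esub> (p ^ Suc k) = \<one>\<^bsub>G Mod level_kernel n\<^esub>"
    if y: "y \<in> carrier (G Mod level_kernel n)" for y
  proof -
    obtain z where "z \<in> carrier G" "y = level_kernel n #> z"
      using y by (auto simp only: carrier_FactGroup)
    then show ?thesis using level_quotient_pow_eq_one all by blast
  qed
  then show "0 < p ^ Suc k \<and> (\<forall>y\<in>carrier (G Mod level_kernel n).
      y [^]\<^bsub>G Mod level_kernel n\<^esub> (p ^ Suc k) = \<one>\<^bsub>G Mod level_kernel n\<^esub>)"
    using p_gt_0 by simp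
next
  fix m :: nat assume m: "0 < m \<and> (\<forall>y\<in>carrier (G Mod level_kernel n).
      y [^]\<^bsub>G Mod level_kernel n\<^esub> m = \<one>\<^bsub>G Mod level_kernel n\<^esub>)"
  have "level_kernel n #> x \<in> carrier (G Mod level_kernel n)"
    using x by (auto simp: carrier_FactGroup)
  then have "St n (x [^] m)" using m level_quotient_pow_eq_one[OF x(1)] by blast
  then show "p ^ Suc k \<le> m" using prime_power_dvd_if_fixes_level[OF x(1) _ x(2)] m by (simp add: dvd_imp_le)
qed

end

section \<open>Automorphisms of the rooted tree\<close>

lemma carrier_Aut_tree: "f \<in> carrier (Aut_tree p) \<longleftrightarrow>
    f \<in> extensional (words p) \<and> bij_betw f (words p) (words p) \<and> f [] = [] \<and>
    (\<forall>u\<in>words p. \<forall>v\<in>words p. child_of p v u \<longleftrightarrow> child_of p (f v) (f u))"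
  by (simp add: Aut_tree_def)

lemma mult_Aut_tree: "f \<otimes>\<^bsub>Aut_tree p\<^esub> g = compose (words p) g f"
  and one_Aut_tree: "\<one>\<^bsub>Aut_tree p\<^esub> = (\<lambda>w\<in>words p. w)"
  by (simp_all add: Aut_tree_def)

lemma append_words: "\<lbrakk>u \<in> words p; v \<in> words p\<rbrakk> \<Longrightarrow> u @ v \<in> words p"
  by simp

lemma Aut_tree_word: "\<lbrakk>f \<in> carrier (Aut_tree p); u \<in> words p\<rbrakk> \<Longrightarrow> f u \<in> words p"
  by (auto simp: carrier_Aut_tree bij_betw_def)

lemma Aut_tree_Nil: "f \<in> carrier (Aut_tree p) \<Longrightarrow> f [] = []"
  by (simp add: carrier_Aut_tree)

lemma Aut_tree_inj: "\<lbrakk>f \<in> carrier (Aut_tree p); u \<in> words p; v \<in> words p; f u = f v\<rbrakk> \<Longrightarrow> u = v"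
  by (auto simp: carrier_Aut_tree bij_betw_def inj_on_def)

lemma Aut_tree_surj: "\<lbrakk>f \<in> carrier (Aut_tree p); v \<in> words p\<rbrakk> \<Longrightarrow> \<exists>u\<in>words p. f u = v"
  unfolding carrier_Aut_tree bij_betw_def by (metis imageE)

lemma Aut_tree_child:
  assumes f: "f \<in> carrier (Aut_tree p)" and u: "u \<in> words p" and x: "x \<in> alphabet p"
  shows "\<exists>y\<in>alphabet p. f (u @ [x]) = f u @ [y]"
proof -
  have "child_of p (u @ [x]) u" using x by (auto simp: child_of_def)
  then have "child_of p (f (u @ [x])) (f u)" using f u x by (simp add: carrier_Aut_tree)
  then show ?thesis by (auto simp: child_of_def)
qed

text \<open>For a bijection it suffices that children go to children; the converse implication in the definition of
automorphisms follows because every nonempty word is the child of exactly one word.\<close>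

lemma Aut_treeI:
  assumes ext: "f \<in> extensional (words p)" and bij: "bij_betw f (words p) (words p)"
    and Nil: "f [] = []"
    and child: "\<And>u x. \<lbrakk>u \<in> words p; x \<in> alphabet p\<rbrakk> \<Longrightarrow> \<exists>y\<in>alphabet p. f (u @ [x]) = f u @ [y]"
  shows "f \<in> carrier (Aut_tree p)"
proof -
  have "child_of p v u \<longleftrightarrow> child_of p (f v) (f u)" if u: "u \<in> words p" and v: "v \<in> words p" for u v
  proof
    assume "child_of p v u"
    then show "child_of p (f v) (f u)" using child[OF u] by (fastforce simp: child_of_def)
  next
    assume fc: "child_of p (f v) (f u)"
    show "child_of p v u"
    proof (cases v rule: rev_cases)
      case Nil
      then show ?thesis using fc \<open>f [] = []\<close> by (simp add: child_of_def)
    next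
      case (snoc w x)
      then have w: "w \<in> words p" "x \<in> alphabet p" using v by auto
      obtain y where "f v = f w @ [y]" using child[OF w] snoc by blast
      then have "f w = f u" using fc by (auto simp: child_of_def)
      then have "w = u" using bij w u by (auto simp: bij_betw_def inj_on_def)
      then show ?thesis using snoc w by (auto simp: child_of_def)
    qed
  qed
  then show ?thesis using ext bij Nil by (simp add: carrier_Aut_tree)
qed

lemma Aut_tree_append:
  assumes f: "f \<in> carrier (Aut_tree p)" and u: "u \<in> words p" and v: "v \<in> words p"
  shows "\<exists>w\<in>words p. f (u @ v) = f u @ w \<and> length w = length v"
  using v
proof (induction v rule: rev_induct)
  case (snoc x v)
  then have v: "v \<in> words p" "x \<in> alphabet p" by auto
  obtain w where w: "w \<in> words p" "f (u @ v) = f u @ w" "length w = length v" using snoc v by auto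
  obtain y where "y \<in> alphabet p" "f ((u @ v) @ [x]) = f (u @ v) @ [y]"
    using Aut_tree_child[OF f append_words[OF u v(1)] v(2)] by blast
  then show ?case using w by (intro bexI[of _ "w @ [y]"]) auto
qed auto

lemma Aut_tree_length: "\<lbrakk>f \<in> carrier (Aut_tree p); u \<in> words p\<rbrakk> \<Longrightarrow> length (f u) = length u"
  using Aut_tree_append[of f p "[]" u] by (auto simp: Aut_tree_Nil)

text \<open>Lengths are preserved, so dropping \<open>length u\<close> letters removes exactly \<open>f u\<close>.\<close>

lemma tree_section_append:
  assumes "f \<in> carrier (Aut_tree p)" "u \<in> words p" "v \<in> words p"
  shows "f (u @ v) = f u @ tree_section p f u v"
  using Aut_tree_append[OF assms] assms(3) Aut_tree_length[OF assms(1,2)]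
  by (auto simp: tree_section_def)

lemma tree_section_closed:
  assumes f: "f \<in> carrier (Aut_tree p)" and u: "u \<in> words p"
  shows "tree_section p f u \<in> carrier (Aut_tree p)"
proof (rule Aut_treeI)
  note app = tree_section_append[OF f u]
  show "tree_section p f u \<in> extensional (words p)" by (simp add: tree_section_def)
  show "tree_section p f u [] = []" using app[of "[]"] by simp
  show "\<exists>y\<in>alphabet p. tree_section p f u (v @ [x]) = tree_section p f u v @ [y]"
    if v: "v \<in> words p" and x: "x \<in> alphabet p" for v x
  proof -
    obtain y where "y \<in> alphabet p" "f ((u @ v) @ [x]) = f (u @ v) @ [y]"
      using Aut_tree_child[OF f append_words[OF u v] x] by blast
    then show ?thesis using app[OF v] app[of "v @ [x]"] v x by auto
  qed
  have closed: "tree_section p f u v \<in> words p" if "v \<in> words p" for v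
    using app[OF that] Aut_tree_word[OF f append_words[OF u that]] by (metis append_in_lists_conv)
  have inj: "v = w" if "v \<in> words p" "w \<in> words p" "tree_section p f u v = tree_section p f u w" for v w
    using Aut_tree_inj[OF f append_words[OF u that(1)] append_words[OF u that(2)]] app that by simp
  have surj: "\<exists>v\<in>words p. tree_section p f u v = w" if w: "w \<in> words p" for w
  proof -
    obtain z where z: "z \<in> words p" "f z = f u @ w"
      using Aut_tree_surj[OF f append_words[OF Aut_tree_word[OF f u] w]] by blast
    define z1 z2 where "z1 = take (length u) z" and "z2 = drop (length u) z"
    have zz: "z = z1 @ z2" "z1 \<in> words p" "z2 \<in> words p"
      using z(1) unfolding z1_def z2_def by (auto dest: in_set_takeD in_set_dropD simp: in_lists_conv_set)
    have "length z \<ge> length u"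
      using Aut_tree_length[OF f z(1)] Aut_tree_length[OF f u] z(2) by simp
    then have "length (f z1) = length (f u)"
      using Aut_tree_length[OF f zz(2)] Aut_tree_length[OF f u] by (simp add: z1_def)
    moreover have "f z1 @ tree_section p f z1 z2 = f u @ w"
      using tree_section_append[OF f zz(2,3)] zz(1) z(2) by simp
    ultimately have "f z1 = f u" by simp
    then have "z1 = u" using Aut_tree_inj[OF f zz(2) u] by blast
    then show ?thesis using app[OF zz(3)] zz z(2) by auto
  qed
  show "bij_betw (tree_section p f u) (words p) (words p)"
    using inj closed surj by (intro bij_betwI') metis+
qed

lemma group_Aut_tree: "group (Aut_tree p)"
proof (rule groupI)
  fix f g assume f: "f \<in> carrier (Aut_tree p)" and g: "g \<in> carrier (Aut_tree p)"
  show "f \<otimes>\<^bsub>Aut_tree p\<^esub> g \<in> carrier (Aut_tree p)"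
  proof (rule Aut_treeI)
    show "f \<otimes>\<^bsub>Aut_tree p\<^esub> g \<in> extensional (words p)" by (simp add: mult_Aut_tree)
    show "bij_betw (f \<otimes>\<^bsub>Aut_tree p\<^esub> g) (words p) (words p)"
      unfolding mult_Aut_tree using f g by (intro bij_betw_compose[of _ _ "words p"]) (auto simp: carrier_Aut_tree)
    show "(f \<otimes>\<^bsub>Aut_tree p\<^esub> g) [] = []"
      using f g by (simp add: mult_Aut_tree compose_def Aut_tree_Nil)
    show "\<exists>y\<in>alphabet p. (f \<otimes>\<^bsub>Aut_tree p\<^esub> g) (u @ [x]) = (f \<otimes>\<^bsub>Aut_tree p\<^esub> g) u @ [y]"
      if u: "u \<in> words p" and x: "x \<in> alphabet p" for u x
    proof -
      obtain y where y: "y \<in> alphabet p" "f (u @ [x]) = f u @ [y]" using Aut_tree_child[OF f u x] by blast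
      obtain z where "z \<in> alphabet p" "g (f u @ [y]) = g (f u) @ [z]"
        using Aut_tree_child[OF g Aut_tree_word[OF f u] y(1)] by blast
      then show ?thesis using y u x by (simp add: mult_Aut_tree compose_def)
    qed
  qed
next
  show "\<one>\<^bsub>Aut_tree p\<^esub> \<in> carrier (Aut_tree p)"
    unfolding one_Aut_tree by (rule Aut_treeI) (auto simp: bij_betw_def inj_on_def)
next
  fix f g h assume "f \<in> carrier (Aut_tree p)" "g \<in> carrier (Aut_tree p)" "h \<in> carrier (Aut_tree p)"
  then show "f \<otimes>\<^bsub>Aut_tree p\<^esub> g \<otimes>\<^bsub>Aut_tree p\<^esub> h = f \<otimes>\<^bsub>Aut_tree p\<^esub> (g \<otimes>\<^bsub>Aut_tree p\<^esub> h)"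
    unfolding mult_Aut_tree by (intro ext) (simp add: compose_def Aut_tree_word)
next
  fix f assume f: "f \<in> carrier (Aut_tree p)"
  show "\<one>\<^bsub>Aut_tree p\<^esub> \<otimes>\<^bsub>Aut_tree p\<^esub> f = f"
    using f unfolding mult_Aut_tree one_Aut_tree
    by (intro ext) (auto simp: compose_def carrier_Aut_tree extensional_def)
  let ?g = "restrict (inv_into (words p) f) (words p)"
  have bij: "bij_betw f (words p) (words p)" using f by (simp add: carrier_Aut_tree)
  have gf: "f (?g v) = v" "?g v \<in> words p" if "v \<in> words p" for v
    using that bij by (auto simp: bij_betw_def f_inv_into_f inv_into_into)
  have fg: "?g (f v) = v" if "v \<in> words p" for v
    using that bij Aut_tree_word[OF f that] by (simp add: bij_betw_def)
  have "?g \<in> carrier (Aut_tree p)"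
  proof (rule Aut_treeI)
    show "bij_betw ?g (words p) (words p)"
      using bij_betw_inv_into[OF bij] by (simp add: bij_betw_cong[of "words p" ?g "inv_into (words p) f"])
    show "?g [] = []" using fg[of "[]"] f by (simp add: Aut_tree_Nil)
    show "\<exists>y\<in>alphabet p. ?g (u @ [x]) = ?g u @ [y]" if u: "u \<in> words p" and x: "x \<in> alphabet p" for u x
    proof -
      have ux: "u @ [x] \<in> words p" using u x by simp
      have "child_of p (f (?g (u @ [x]))) (f (?g u))"
        using gf(1)[OF u] gf(1)[OF ux] x by (auto simp: child_of_def)
      then have "child_of p (?g (u @ [x])) (?g u)"
        using f gf(2)[OF u] gf(2)[OF ux] by (simp only: carrier_Aut_tree)
      then show ?thesis by (auto simp: child_of_def)
    qed
  qed simp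
  moreover have "?g \<otimes>\<^bsub>Aut_tree p\<^esub> f = \<one>\<^bsub>Aut_tree p\<^esub>"
    unfolding mult_Aut_tree one_Aut_tree by (rule ext) (use gf(1) in \<open>simp add: compose_def\<close>)
  ultimately show "\<exists>g\<in>carrier (Aut_tree p). g \<otimes>\<^bsub>Aut_tree p\<^esub> f = \<one>\<^bsub>Aut_tree p\<^esub>" by blast
qed

lemma mult_Aut_tree_apply: "w \<in> words p \<Longrightarrow> (f \<otimes>\<^bsub>Aut_tree p\<^esub> g) w = g (f w)"
  by (simp add: mult_Aut_tree compose_def)

lemma Aut_tree_eqI:
  "\<lbrakk>f \<in> carrier (Aut_tree p); g \<in> carrier (Aut_tree p); \<And>w. w \<in> words p \<Longrightarrow> f w = g w\<rbrakk> \<Longrightarrow> f = g"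
  by (rule extensionalityI[of f "words p" g]) (simp_all only: carrier_Aut_tree)

definition letter_map :: "(nat list \<Rightarrow> nat list) \<Rightarrow> nat \<Rightarrow> nat"
  where "letter_map f x = hd (f [x])"

lemma letter_map:
  assumes f: "f \<in> carrier (Aut_tree p)" and x: "x \<in> alphabet p"
  shows "letter_map f x \<in> alphabet p" "f [x] = [letter_map f x]"
  using Aut_tree_child[OF f _ x, of "[]"] Aut_tree_Nil[OF f] by (auto simp: letter_map_def)

lemma Aut_tree_Cons:
  assumes f: "f \<in> carrier (Aut_tree p)" and x: "x \<in> alphabet p" and v: "v \<in> words p"
  shows "f (x # v) = letter_map f x # tree_section p f [x] v"
  using tree_section_append[OF f _ v, of "[x]"] letter_map[OF f x] x by simp

lemma letter_map_mult:
  assumes "f \<in> carrier (Aut_tree p)" "x \<in> alphabet p"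
  shows "letter_map (f \<otimes>\<^bsub>Aut_tree p\<^esub> g) x = letter_map g (letter_map f x)"
proof -
  have "(f \<otimes>\<^bsub>Aut_tree p\<^esub> g) [x] = g [letter_map f x]"
    using letter_map(2)[OF assms] assms(2) by (simp add: mult_Aut_tree_apply)
  then show ?thesis by (simp only: letter_map_def)
qed

lemma tree_section_mult:
  assumes f: "f \<in> carrier (Aut_tree p)" and g: "g \<in> carrier (Aut_tree p)" and x: "x \<in> alphabet p"
  shows "tree_section p (f \<otimes>\<^bsub>Aut_tree p\<^esub> g) [x] =
    tree_section p f [x] \<otimes>\<^bsub>Aut_tree p\<^esub> tree_section p g [letter_map f x]"
proof -
  interpret A: group "Aut_tree p" by (rule group_Aut_tree)
  have fg: "f \<otimes>\<^bsub>Aut_tree p\<^esub> g \<in> carrier (Aut_tree p)" using f g by (rule A.m_closed)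
  have y: "letter_map f x \<in> alphabet p" by (rule letter_map[OF f x])
  have sf: "tree_section p f [x] \<in> carrier (Aut_tree p)" using x by (intro tree_section_closed f) simp
  have sg: "tree_section p g [letter_map f x] \<in> carrier (Aut_tree p)"
    using y by (intro tree_section_closed g) simp
  have sfg: "tree_section p (f \<otimes>\<^bsub>Aut_tree p\<^esub> g) [x] \<in> carrier (Aut_tree p)"
    using x by (intro tree_section_closed fg) simp
  show ?thesis
  proof (rule Aut_tree_eqI[OF sfg A.m_closed[OF sf sg]])
    fix w assume w: "w \<in> words p"
    have xw: "x # w \<in> words p" using x w by simp
    have "letter_map (f \<otimes>\<^bsub>Aut_tree p\<^esub> g) x # tree_section p (f \<otimes>\<^bsub>Aut_tree p\<^esub> g) [x] w =
        g (letter_map f x # tree_section p f [x] w)"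
      using Aut_tree_Cons[OF fg x w] Aut_tree_Cons[OF f x w] mult_Aut_tree_apply[OF xw] by metis
    also have "\<dots> = letter_map g (letter_map f x) #
        tree_section p g [letter_map f x] (tree_section p f [x] w)"
      by (rule Aut_tree_Cons[OF g y Aut_tree_word[OF sf w]])
    finally show "tree_section p (f \<otimes>\<^bsub>Aut_tree p\<^esub> g) [x] w =
        (tree_section p f [x] \<otimes>\<^bsub>Aut_tree p\<^esub> tree_section p g [letter_map f x]) w"
      using w by (simp add: mult_Aut_tree_apply)
  qed
qed

section \<open>Cyclic labels\<close>

text \<open>The letter of \<open>{1..p}\<close> in a given residue class; the class of \<open>0\<close> is represented by \<open>p\<close>.\<close>

definition residue_letter :: "nat \<Rightarrow> int \<Rightarrow> nat"
  where "residue_letter p i = nat ((i - 1) mod int p) + 1"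

lemma residue_letter_mem: "p > 0 \<Longrightarrow> residue_letter p i \<in> alphabet p"
  unfolding residue_letter_def alphabet_def using pos_mod_bound[of "int p" "i - 1"]
  by (auto simp: nat_less_iff Suc_le_eq)

lemma residue_letter_mod: "p > 0 \<Longrightarrow> [int (residue_letter p i) = i] (mod int p)"
  unfolding residue_letter_def by (simp add: cong_def mod_simps)

lemma letters_eqI: 
  assumes "x \<in> alphabet p" "y \<in> alphabet p" "[int x = int y] (mod int p)" shows "x = y"
proof -
  have "\<bar>int x - int y\<bar> < int p" using assms(1,2) by (auto simp: alphabet_def)
  then show ?thesis using assms(3) by (metis cong_iff_dvd_diff dvd_imp_le_int eq_iff_diff_eq_0 not_le of_nat_eq_iff abs_of_nat)
qed

lemma residue_letter_eq: "\<lbrakk>x \<in> alphabet p; [int x = i] (mod int p)\<rbrakk> \<Longrightarrow> residue_letter p i = x"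
proof -
  assume x: "x \<in> alphabet p" and c: "[int x = i] (mod int p)"
  then have p: "p > 0" by (auto simp: alphabet_def)
  show ?thesis
    using letters_eqI[OF residue_letter_mem[OF p] x] residue_letter_mod[OF p, of i] c cong_sym cong_trans
    by blast
qed

text \<open>The letter \<open>p\<close> stands for the residue \<open>0\<close>, so its image is the amount of the rotation.\<close>

definition rotation :: "nat \<Rightarrow> (nat list \<Rightarrow> nat list) \<Rightarrow> int"
  where "rotation p f = int (letter_map f p)"

definition residue_section :: "nat \<Rightarrow> (nat list \<Rightarrow> nat list) \<Rightarrow> int \<Rightarrow> nat list \<Rightarrow> nat list"
  where "residue_section p f i = tree_section p f [residue_letter p i]"

definition rotational :: "nat \<Rightarrow> (nat list \<Rightarrow> nat list) \<Rightarrow> bool"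
  where "rotational p f \<longleftrightarrow> (\<forall>x\<in>alphabet p. [int (letter_map f x) = int x + rotation p f] (mod int p))"

lemma rotationalI:
  assumes p: "p > 0" and c: "\<And>x. x \<in> alphabet p \<Longrightarrow> [int (letter_map f x) = int x + c] (mod int p)"
  shows "rotational p f" "[rotation p f = c] (mod int p)"
proof -
  have "p \<in> alphabet p" using p by (simp add: alphabet_def)
  from c[OF this] show r: "[rotation p f = c] (mod int p)"
    unfolding rotation_def by (simp add: cong_def)
  show "rotational p f"
    unfolding rotational_def using c r by (meson cong_add cong_refl cong_sym cong_trans)
qed

lemma rotational_mult:
  assumes p: "p > 0" and f: "f \<in> carrier (Aut_tree p)" "rotational p f" and g: "rotational p g"
  shows "rotational p (f \<otimes>\<^bsub>Aut_tree p\<^esub> g)"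
    and "[rotation p (f \<otimes>\<^bsub>Aut_tree p\<^esub> g) = rotation p f + rotation p g] (mod int p)"
proof -
  have "[int (letter_map (f \<otimes>\<^bsub>Aut_tree p\<^esub> g) x) = int x + (rotation p f + rotation p g)] (mod int p)"
    if x: "x \<in> alphabet p" for x
  proof -
    have "[int (letter_map g (letter_map f x)) = int (letter_map f x) + rotation p g] (mod int p)"
      using g letter_map[OF f(1) x] unfolding rotational_def by blast
    also have "[int (letter_map f x) + rotation p g = int x + rotation p f + rotation p g] (mod int p)"
      using f(2) x unfolding rotational_def by (intro cong_add) auto
    finally show ?thesis using letter_map_mult[OF f(1) x] by (simp add: add.assoc)
  qed
  then show "rotational p (f \<otimes>\<^bsub>Aut_tree p\<^esub> g)"
    "[rotation p (f \<otimes>\<^bsub>Aut_tree p\<^esub> g) = rotation p f + rotation p g] (mod int p)"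
    using rotationalI[OF p] by blast+
qed

lemma letter_map_residue:
  assumes p: "p > 0" and f: "f \<in> carrier (Aut_tree p)" "rotational p f"
  shows "letter_map f (residue_letter p i) = residue_letter p (i + rotation p f)"
proof -
  have x: "residue_letter p i \<in> alphabet p" using p by (rule residue_letter_mem)
  have "[int (letter_map f (residue_letter p i)) = int (residue_letter p i) + rotation p f] (mod int p)"
    using f(2) x unfolding rotational_def by blast
  also have "[int (residue_letter p i) + rotation p f = i + rotation p f] (mod int p)"
    using residue_letter_mod[OF p] by (intro cong_add) auto
  finally show ?thesis using residue_letter_eq letter_map(1)[OF f(1) x] by metis
qed

lemma residue_section_mult:
  assumes p: "p > 0" and f: "f \<in> carrier (Aut_tree p)" "rotational p f"
    and g: "g \<in> carrier (Aut_tree p)"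
  shows "residue_section p (f \<otimes>\<^bsub>Aut_tree p\<^esub> g) i =
    residue_section p f i \<otimes>\<^bsub>Aut_tree p\<^esub> residue_section p g (i + rotation p f)"
  unfolding residue_section_def
  using tree_section_mult[OF f(1) g residue_letter_mem[OF p]] letter_map_residue[OF p f] by simp

lemma rotational_inv:
  assumes p: "p > 0" and f: "f \<in> carrier (Aut_tree p)" "rotational p f"
  shows "rotational p (inv\<^bsub>Aut_tree p\<^esub> f)"
    and "residue_section p (inv\<^bsub>Aut_tree p\<^esub> f) i =
      inv\<^bsub>Aut_tree p\<^esub> (residue_section p f (i - rotation p f))"
proof -
  interpret A: group "Aut_tree p" by (rule group_Aut_tree)
  let ?g = "inv\<^bsub>Aut_tree p\<^esub> f"
  have g: "?g \<in> carrier (Aut_tree p)" using f by simp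
  have "[int (letter_map ?g x) = int x + - rotation p f] (mod int p)" if x: "x \<in> alphabet p" for x
  proof -
    have y: "letter_map ?g x \<in> alphabet p" using letter_map[OF g x] by blast
    have "letter_map f (letter_map ?g x) = letter_map (?g \<otimes>\<^bsub>Aut_tree p\<^esub> f) x"
      using letter_map_mult[OF g x] by simp
    also have "\<dots> = x" using f x by (simp add: one_Aut_tree letter_map_def)
    finally have "[int x = int (letter_map ?g x) + rotation p f] (mod int p)"
      using f(2) y unfolding rotational_def by metis
    then show ?thesis by (simp add: cong_iff_dvd_diff dvd_diff_commute algebra_simps)
  qed
  then show "rotational p ?g" by (rule rotationalI(1)[OF p])
  have s: "residue_section p f (i - rotation p f) \<in> carrier (Aut_tree p)"
    "residue_section p ?g i \<in> carrier (Aut_tree p)"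
    unfolding residue_section_def using residue_letter_mem[OF p] by (auto intro!: tree_section_closed f g)
  have "residue_section p f (i - rotation p f) \<otimes>\<^bsub>Aut_tree p\<^esub> residue_section p ?g i
      = residue_section p \<one>\<^bsub>Aut_tree p\<^esub> (i - rotation p f)"
    using residue_section_mult[OF p f g, of "i - rotation p f"] f by simp
  also have "\<dots> = \<one>\<^bsub>Aut_tree p\<^esub>"
    using residue_letter_mem[OF p] by (auto simp: residue_section_def tree_section_def one_Aut_tree fun_eq_iff)
  finally have "residue_section p f (i - rotation p f) \<otimes>\<^bsub>Aut_tree p\<^esub> residue_section p ?g i = \<one>\<^bsub>Aut_tree p\<^esub>" .
  then show "residue_section p ?g i = inv\<^bsub>Aut_tree p\<^esub> (residue_section p f (i - rotation p f))"
    using s by (metis A.inv_equality A.inv_inv A.inv_closed)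
qed

lemma rotational_one: "p > 0 \<Longrightarrow> rotational p \<one>\<^bsub>Aut_tree p\<^esub>"
  by (rule rotationalI(1)[where c = 0]) (simp_all add: one_Aut_tree letter_map_def)

lemma residue_section_one: "p > 0 \<Longrightarrow> residue_section p \<one>\<^bsub>Aut_tree p\<^esub> i = \<one>\<^bsub>Aut_tree p\<^esub>"
  using residue_letter_mem[of p i]
  by (auto simp: residue_section_def tree_section_def one_Aut_tree fun_eq_iff)

lemma rooted_aut_facts:
  assumes p: "p > 0"
  shows "rooted_aut p \<in> carrier (Aut_tree p)" "rotational p (rooted_aut p)"
    "[rotation p (rooted_aut p) = 1] (mod int p)"
    "residue_section p (rooted_aut p) i = \<one>\<^bsub>Aut_tree p\<^esub>"
proof -
  have s: "sigma p x \<in> alphabet p" "[int (sigma p x) = int x + 1] (mod int p)" if "x \<in> alphabet p" for x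
    using that by (auto simp: sigma_def alphabet_def cong_def add.commute)
  have r: "rooted_aut p (x # w) = sigma p x # w" if "x \<in> alphabet p" "w \<in> words p" for x w
    using that by (simp add: rooted_aut_def)
  have inj: "x = y" if "x \<in> alphabet p" "y \<in> alphabet p" "sigma p x = sigma p y" for x y
    using that unfolding sigma_def alphabet_def by (cases "x = p"; cases "y = p") simp_all
  have surj: "\<exists>x\<in>alphabet p. sigma p x = y" if "y \<in> alphabet p" for y
    using that p by (intro bexI[of _ "if y = 1 then p else y - 1"]) (auto simp: sigma_def alphabet_def)
  show a: "rooted_aut p \<in> carrier (Aut_tree p)"
  proof (rule Aut_treeI)
    show "bij_betw (rooted_aut p) (words p) (words p)"
    proof (rule bij_betwI')
      fix u v assume uv: "u \<in> words p" "v \<in> words p"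
      show "rooted_aut p u = rooted_aut p v \<longleftrightarrow> u = v"
      proof (cases u; cases v)
        fix x y u' v' assume "u = x # u'" "v = y # v'"
        then show ?thesis using uv r inj[of x y] by auto
      qed (use uv in \<open>auto simp: rooted_aut_def\<close>)
    next
      fix u assume "u \<in> words p"
      then show "rooted_aut p u \<in> words p" using s(1) by (auto simp: rooted_aut_def split: list.splits)
    next
      fix v assume v: "v \<in> words p"
      show "\<exists>u\<in>words p. v = rooted_aut p u"
      proof (cases v)
        case Nil then show ?thesis by (intro bexI[of _ "[]"]) (auto simp: rooted_aut_def)
      next
        case (Cons y w)
        then obtain x where "x \<in> alphabet p" "sigma p x = y" using v surj by auto
        then show ?thesis using Cons v r[of x w] by (intro bexI[of _ "x # w"]) auto
      qed
    qed
    show "\<exists>y\<in>alphabet p. rooted_aut p (u @ [x]) = rooted_aut p u @ [y]"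
      if "u \<in> words p" "x \<in> alphabet p" for u x
      using that s by (cases u) (auto simp: rooted_aut_def)
  qed (simp_all add: rooted_aut_def)
  have l: "letter_map (rooted_aut p) x = sigma p x" if "x \<in> alphabet p" for x
    using that r[of x "[]"] by (simp add: letter_map_def)
  show "rotational p (rooted_aut p)" "[rotation p (rooted_aut p) = 1] (mod int p)"
    using rotationalI[OF p, of "rooted_aut p" 1] s l by auto
  show "residue_section p (rooted_aut p) i = \<one>\<^bsub>Aut_tree p\<^esub>"
    using r[OF residue_letter_mem[OF p]]
    by (auto simp: residue_section_def tree_section_def one_Aut_tree fun_eq_iff)
qed

section \<open>Directed automorphisms of the tree\<close>

text \<open>The exponent at the letter \<open>x\<close>: the defining vector is read cyclically from the letter \<open>j\<close> on.\<close>

definition path_exponent :: "nat \<Rightarrow> nat \<Rightarrow> (nat \<Rightarrow> int) \<Rightarrow> nat \<Rightarrow> int"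
  where "path_exponent p j e x = (if x < j then e (p - j + x) else e (x - j))"

lemma directed_along_iff:
  assumes j: "j \<in> alphabet p"
  shows "directed_along p j e b \<longleftrightarrow> b \<in> level_stabilizer p 1 \<and>
    (\<forall>x\<in>alphabet p. tree_section p b [x] =
      (if x = j then b else rooted_aut p [^]\<^bsub>Aut_tree p\<^esub> path_exponent p j e x))"
proof -
  let ?a = "\<lambda>i. rooted_aut p [^]\<^bsub>Aut_tree p\<^esub> e i"
  let ?R = "map ?a [p - j + 1..<p] @ [b] @ map ?a [1..<p - j + 1]"
  have j': "1 \<le> j" "j \<le> p" using j by (auto simp: alphabet_def)
  have nth: "?R ! k = (if Suc k = j then b else rooted_aut p [^]\<^bsub>Aut_tree p\<^esub> path_exponent p j e (Suc k))"
    if "k < p" for k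
  proof -
    consider "Suc k < j" | "Suc k = j" | "j \<le> k" by linarith
    then show ?thesis
    proof cases
      case 1
      then have "k < j - 1" by simp
      then show ?thesis using 1 j' by (simp add: nth_append path_exponent_def)
    next
      case 2
      then have "\<not> k < j - 1" "k - (j - 1) = 0" by auto
      then show ?thesis using 2 j' by (simp add: nth_append)
    next
      case 3
      have l: "length (map ?a [p - j + 1..<p]) = j - 1" using j' by simp
      have k: "k - (j - 1) = Suc (k - j)" "\<not> k < j - 1" "1 + (k - j) < p - j + 1"
        using 3 j' that by auto
      have "?R ! k = map ?a [1..<p - j + 1] ! (k - j)"
        unfolding nth_append[of "map ?a [p - j + 1..<p]"] l using k by simp
      also have "\<dots> = ?a (1 + (k - j))" using k(3) by (simp del: upt_Suc)
      finally show ?thesis using 3 by (simp add: path_exponent_def Suc_diff_le)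
    qed
  qed
  have "length (psi p b) = p" "length ?R = p" using j' by (auto simp: psi_def)
  then have "psi p b = ?R \<longleftrightarrow> (\<forall>k<p. psi p b ! k = ?R ! k)"
    unfolding list_eq_iff_nth_eq by (simp only: simp_thms)
  also have "\<dots> \<longleftrightarrow> (\<forall>k<p. tree_section p b [Suc k] = ?R ! k)"
  proof -
    have "psi p b ! k = tree_section p b [Suc k]" if "k < p" for k
      using that by (simp add: psi_def del: upt_Suc)
    then show ?thesis by simp
  qed
  also have "\<dots> \<longleftrightarrow> (\<forall>x\<in>alphabet p. tree_section p b [x] = ?R ! (x - 1))"
  proof -
    have "alphabet p = Suc ` {..<p}" by (auto simp: alphabet_def image_iff) (metis Suc_le_D lessThan_iff less_eq_Suc_le)
    then show ?thesis by auto
  qed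
  also have "\<dots> \<longleftrightarrow> (\<forall>x\<in>alphabet p. tree_section p b [x] =
      (if x = j then b else rooted_aut p [^]\<^bsub>Aut_tree p\<^esub> path_exponent p j e x))"
  proof (rule ball_cong[OF refl])
    fix x assume "x \<in> alphabet p"
    then have "x - 1 < p" "Suc (x - 1) = x" by (auto simp: alphabet_def)
    then show "tree_section p b [x] = ?R ! (x - 1) \<longleftrightarrow> tree_section p b [x] =
      (if x = j then b else rooted_aut p [^]\<^bsub>Aut_tree p\<^esub> path_exponent p j e x)"
      using nth[of "x - 1"] by simp
  qed
  finally show ?thesis unfolding directed_along_def by blast
qed

text \<open>The directed automorphism, as a function by recursion along its path. The argument \<open>c\<close>
gives the exponents at the letters; negating it inverts the function.\<close>

primrec path_fun :: "nat \<Rightarrow> nat \<Rightarrow> (nat \<Rightarrow> int) \<Rightarrow> nat list \<Rightarrow> nat list"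
  where
    "path_fun p j c [] = []"
  | "path_fun p j c (x # w) =
      x # (if x = j then path_fun p j c w else (rooted_aut p [^]\<^bsub>Aut_tree p\<^esub> c x) w)"

lemma ex_directed_along:
  assumes p: "p > 0" and j: "j \<in> alphabet p"
  shows "\<exists>b. directed_along p j e b"
proof -
  interpret A: group "Aut_tree p" by (rule group_Aut_tree)
  let ?a = "rooted_aut p"
  have a: "?a [^]\<^bsub>Aut_tree p\<^esub> (k::int) \<in> carrier (Aut_tree p)" for k
    using rooted_aut_facts(1)[OF p] by (rule A.int_pow_closed)
  have mem: "path_fun p j c w \<in> words p" if "w \<in> words p" for w c
    using that
  proof (induction w)
    case (Cons y w)
    then show ?case using Aut_tree_word[OF a, of w "c y"] by auto
  qed simp
  have child: "\<exists>y\<in>alphabet p. path_fun p j c (w @ [x]) = path_fun p j c w @ [y]"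
    if "w \<in> words p" and x: "x \<in> alphabet p" for w x c
    using that(1)
  proof (induction w)
    case Nil
    then show ?case using x Aut_tree_Nil[OF a] by auto
  next
    case (Cons y w)
    then have "w \<in> words p" by simp
    from Aut_tree_child[OF a this x] show ?case using Cons.IH \<open>w \<in> words p\<close> by auto
  qed
  have inv: "path_fun p j (\<lambda>x. - c x) (path_fun p j c w) = w" if "w \<in> words p" for w c
    using that
  proof (induction w)
    case (Cons x w)
    then have "w \<in> words p" by simp
    have "?a [^]\<^bsub>Aut_tree p\<^esub> c x \<otimes>\<^bsub>Aut_tree p\<^esub> ?a [^]\<^bsub>Aut_tree p\<^esub> (- c x) = \<one>\<^bsub>Aut_tree p\<^esub>"
      using rooted_aut_facts(1)[OF p] by (simp add: A.int_pow_mult[symmetric])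
    then have "(?a [^]\<^bsub>Aut_tree p\<^esub> (- c x)) ((?a [^]\<^bsub>Aut_tree p\<^esub> c x) w) = w"
      using \<open>w \<in> words p\<close> mult_Aut_tree_apply[OF \<open>w \<in> words p\<close>, of "?a [^]\<^bsub>Aut_tree p\<^esub> c x" "?a [^]\<^bsub>Aut_tree p\<^esub> (- c x)"]
      by (simp add: one_Aut_tree)
    then show ?case using Cons by simp
  qed simp
  have inv': "path_fun p j c (path_fun p j (\<lambda>x. - c x) w) = w" if "w \<in> words p" for w c
    using inv[OF that, of "\<lambda>x. - c x"] by simp
  define c where "c = path_exponent p j e"
  define b where "b = restrict (path_fun p j c) (words p)"
  have b: "b \<in> carrier (Aut_tree p)"
  proof (rule Aut_treeI)
    have "bij_betw (path_fun p j c) (words p) (words p)"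
      by (intro bij_betw_byWitness[of _ "path_fun p j (\<lambda>x. - c x)"] ballI image_subsetI mem inv inv')
    then show "bij_betw b (words p) (words p)"
      unfolding b_def by (simp add: bij_betw_cong[of _ "restrict _ _"])
  qed (use child[of _ _ c] in \<open>simp_all add: b_def\<close>)
  have "b [x] = [x]" if "x \<in> alphabet p" for x
    using that Aut_tree_Nil[OF a] by (simp add: b_def)
  then have "b \<in> level_stabilizer p 1"
    using b by (auto simp: level_stabilizer_def length_Suc_conv)
  moreover have "tree_section p b [x] = (if x = j then b else ?a [^]\<^bsub>Aut_tree p\<^esub> c x)"
    if x: "x \<in> alphabet p" for x
  proof (rule Aut_tree_eqI)
    show "tree_section p b [x] \<in> carrier (Aut_tree p)" using x by (intro tree_section_closed b) simp
    show "(if x = j then b else ?a [^]\<^bsub>Aut_tree p\<^esub> c x) \<in> carrier (Aut_tree p)" using a b by simp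
    show "tree_section p b [x] w = (if x = j then b else ?a [^]\<^bsub>Aut_tree p\<^esub> c x) w"
      if "w \<in> words p" for w
      using that x by (simp add: tree_section_def b_def)
  qed
  ultimately show ?thesis unfolding directed_along_iff[OF j] c_def by blast
qed

section \<open>Multi-EGS-groups as self-similar groups\<close>

text \<open>The families are indexed by integers to match the abstract setting. They are arbitrary sets of directed
automorphisms, so that the results apply to \<open>K\<close> itself and to its subgroup generated by the rooted
automorphism and one directed automorphism.\<close>

locale directed_families =
  fixes p :: nat and D :: "int \<Rightarrow> (nat list \<Rightarrow> nat list) set"
  assumes prime: "Factorial_Ring.prime p"
    and family: "b \<in> D j \<Longrightarrow> nat j \<in> alphabet p \<and> (\<exists>e. directed_along p (nat j) e b)"
begin

definition K :: "(nat list \<Rightarrow> nat list) set"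
  where "K = generate (Aut_tree p) (insert (rooted_aut p) (\<Union>j. D j))"

abbreviation "GK \<equiv> (Aut_tree p)\<lparr>carrier := K\<rparr>"

sublocale A: group "Aut_tree p" by (rule group_Aut_tree)

lemma p_pos: "p > 0"
  using prime prime_gt_0_nat by blast

lemma family_closed: "b \<in> D j \<Longrightarrow> b \<in> carrier (Aut_tree p)"
  using family[of b j] by (auto simp: directed_along_def level_stabilizer_def)

lemma subgroup_K: "subgroup K (Aut_tree p)"
  unfolding K_def using rooted_aut_facts(1)[OF p_pos] family_closed
  by (intro A.generate_is_subgroup) auto

lemma K_closed: "x \<in> K \<Longrightarrow> x \<in> carrier (Aut_tree p)"
  using subgroup_K by (rule subgroup.mem_carrier)

lemma rooted_K: "rooted_aut p \<in> K" and family_K: "b \<in> D j \<Longrightarrow> b \<in> K"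
  unfolding K_def by (auto intro: generate.incl)

lemma rooted_int_pow_K: "rooted_aut p [^]\<^bsub>Aut_tree p\<^esub> (k::int) \<in> K"
  using A.int_pow_consistent[OF subgroup_K rooted_K, of k]
    group.int_pow_closed[OF A.subgroup_imp_group[OF subgroup_K], of "rooted_aut p" k] rooted_K
  by simp

lemma family_rotational:
  assumes b: "b \<in> D j"
  shows "rotational p b" "[rotation p b = 0] (mod int p)"
proof -
  have "[int (letter_map b x) = int x + 0] (mod int p)" if "x \<in> alphabet p" for x
    using family[OF b] that by (auto simp: directed_along_def level_stabilizer_def letter_map_def)
  then show "rotational p b" "[rotation p b = 0] (mod int p)"
    using rotationalI[OF p_pos, of b 0] by auto
qed

lemma family_section:
  assumes b: "b \<in> D j" and i: "\<not> int p dvd i - j"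
  shows "\<exists>k::int. residue_section p b i = rooted_aut p [^]\<^bsub>Aut_tree p\<^esub> k"
    and "directed_along p (nat j) e b \<Longrightarrow>
      residue_section p b i = rooted_aut p [^]\<^bsub>Aut_tree p\<^esub> path_exponent p (nat j) e (residue_letter p i)"
proof -
  have j: "nat j \<in> alphabet p" using family[OF b] by blast
  have x: "residue_letter p i \<in> alphabet p" using p_pos by (rule residue_letter_mem)
  have ne: "residue_letter p i \<noteq> nat j"
  proof
    assume "residue_letter p i = nat j"
    moreover have "int (nat j) = j" using j by (auto simp: alphabet_def)
    ultimately have "[j = i] (mod int p)" using residue_letter_mod[OF p_pos, of i] by simp
    then show False using i by (simp add: cong_iff_dvd_diff dvd_diff_commute)
  qed
  show s: "residue_section p b i = rooted_aut p [^]\<^bsub>Aut_tree p\<^esub> path_exponent p (nat j) e (residue_letter p i)"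
    if "directed_along p (nat j) e b" for e
    using that x ne unfolding directed_along_iff[OF j] residue_section_def by auto
  show "\<exists>k::int. residue_section p b i = rooted_aut p [^]\<^bsub>Aut_tree p\<^esub> k"
    using family[OF b] s by blast
qed

lemma family_section_self:
  assumes b: "b \<in> D j" and i: "int p dvd i - j"
  shows "residue_section p b i = b"
proof -
  have j: "nat j \<in> alphabet p" using family[OF b] by blast
  have "residue_letter p i = nat j"
    using j i by (intro residue_letter_eq) (auto simp: alphabet_def cong_iff_dvd_diff dvd_diff_commute)
  then show ?thesis
    using family[OF b] j unfolding directed_along_iff[OF j] residue_section_def by auto
qed

lemma K_self_similar: "x \<in> K \<Longrightarrow> rotational p x \<and> (\<forall>i. residue_section p x i \<in> K)"
proof -
  assume "x \<in> K"
  then have "x \<in> generate (Aut_tree p) (insert (rooted_aut p) (\<Union>j. D j))" unfolding K_def .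
  then show ?thesis
  proof (induction rule: generate.induct)
    case one
    then show ?case
      using rotational_one residue_section_one p_pos subgroup.one_closed[OF subgroup_K] by simp
  next
    have gen: "rotational p h \<and> (\<forall>i. residue_section p h i \<in> K)"
      if h: "h \<in> insert (rooted_aut p) (\<Union>j. D j)" for h
    proof (cases "h = rooted_aut p")
      case True
      then show ?thesis
        using rooted_aut_facts[OF p_pos] subgroup.one_closed[OF subgroup_K] by simp
    next
      case False
      then obtain j where b: "h \<in> D j" using h by blast
      have "residue_section p h i \<in> K" for i
        using family_section(1)[OF b, of i] family_section_self[OF b, of i] family_K[OF b] rooted_int_pow_K
        by (cases "int p dvd i - j") auto
      then show ?thesis using family_rotational[OF b] by blast
    qed
    {
      case (incl h)
      then show ?case by (rule gen)
    next
      case (inv h)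
      then have "h \<in> carrier (Aut_tree p)" 
        using rooted_aut_facts(1)[OF p_pos] family_closed by auto
      then show ?case using gen[OF inv] rotational_inv[OF p_pos, of h]
          subgroup.m_inv_closed[OF subgroup_K] by simp
    }
  next
    case (eng x y)
    then have "x \<in> carrier (Aut_tree p)" "y \<in> carrier (Aut_tree p)"
      using K_closed unfolding K_def by auto
    then show ?case using eng rotational_mult(1)[OF p_pos] residue_section_mult[OF p_pos]
        subgroup.m_closed[OF subgroup_K] by simp
  qed
qed

lemma fixes_level_iff:
  assumes "x \<in> K"
  shows "fixes_level p (rotation p) (residue_section p) n x \<longleftrightarrow> x \<in> level_stabilizer p n"
  using assms
proof (induction n arbitrary: x)
  case 0
  then show ?case using K_closed Aut_tree_Nil by (auto simp: level_stabilizer_def)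
next
  case (Suc n)
  have x: "x \<in> carrier (Aut_tree p)" "rotational p x"
    using Suc.prems K_closed K_self_similar by blast+
  have IH: "fixes_level p (rotation p) (residue_section p) n (residue_section p x i) \<longleftrightarrow>
      (\<forall>w\<in>words p. length w = n \<longrightarrow> residue_section p x i w = w)" for i
    using Suc K_self_similar K_closed by (auto simp: level_stabilizer_def)
  have res: "residue_letter p (int y) = y" if "y \<in> alphabet p" for y
    using that by (intro residue_letter_eq) auto
  have sec: "x (y # w) = letter_map x y # residue_section p x (int y) w"
    if "y \<in> alphabet p" "w \<in> words p" for y w
    using Aut_tree_Cons[OF x(1) that] res[OF that(1)] by (simp add: residue_section_def)
  have lm: "letter_map x y = residue_letter p (int y + rotation p x)" if "y \<in> alphabet p" for y
    using letter_map_residue[OF p_pos x, of "int y"] res[OF that] by simp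
  have pa: "p \<in> alphabet p" using p_pos by (simp add: alphabet_def)
  show ?case
  proof
    assume L: "fixes_level p (rotation p) (residue_section p) (Suc n) x"
    have "x w = w" if w: "w \<in> words p" "length w = Suc n" for w
    proof -
      obtain y v where yv: "w = y # v" "y \<in> alphabet p" "v \<in> words p" "length v = n"
        using w by (cases w) auto
      have "residue_letter p (int y + rotation p x) = y"
        using L yv by (intro residue_letter_eq) (auto simp: cong_iff_dvd_diff)
      then show ?thesis using sec[OF yv(2,3)] lm[OF yv(2)] L IH yv by simp
    qed
    then show "x \<in> level_stabilizer p (Suc n)" using x by (auto simp: level_stabilizer_def)
  next
    assume L: "x \<in> level_stabilizer p (Suc n)"
    then have fix_w: "x w = w" if "w \<in> words p" "length w = Suc n" for w
      using that by (auto simp: level_stabilizer_def)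
    have "replicate n p \<in> words p" using pa by (auto simp: in_lists_conv_set)
    then have "letter_map x p = p" using sec[OF pa, of "replicate n p"] fix_w[of "p # replicate n p"] pa by simp
    then have "int p dvd rotation p x" by (simp add: rotation_def)
    moreover have "residue_section p x i w = w" if w: "w \<in> words p" "length w = n" for i w
    proof -
      have y: "residue_letter p i \<in> alphabet p" using p_pos by (rule residue_letter_mem)
      have "residue_section p x i = residue_section p x (int (residue_letter p i))"
        using res[OF y] by (simp add: residue_section_def)
      then show ?thesis using sec[OF y w(1)] fix_w[of "residue_letter p i # w"] y w by simp
    qed
    ultimately show "fixes_level p (rotation p) (residue_section p) (Suc n) x" using IH by simp
  qed
qed

lemma generate_GK: "S \<subseteq> K \<Longrightarrow> generate GK S = generate (Aut_tree p) S"
  using A.generate_consistent[OF _ subgroup_K] by blast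

sublocale KS: cyclic_self_similar GK p "rotation p" "residue_section p" "rooted_aut p"
proof -
  interpret GK: group GK using A.subgroup_imp_group[OF subgroup_K] .
  show "cyclic_self_similar GK p (rotation p) (residue_section p) (rooted_aut p)"
  proof
    show "Factorial_Ring.prime p" by (rule prime)
    show "[rotation p (x \<otimes>\<^bsub>GK\<^esub> y) = rotation p x + rotation p y] (mod int p)"
      if "x \<in> carrier GK" "y \<in> carrier GK" for x y
      using that rotational_mult(2)[OF p_pos] K_self_similar K_closed by simp
    show "residue_section p x i \<in> carrier GK" if "x \<in> carrier GK" for x i
      using that K_self_similar by simp
    show "residue_section p (x \<otimes>\<^bsub>GK\<^esub> y) i = residue_section p x i \<otimes>\<^bsub>GK\<^esub> residue_section p y (i + rotation p x)"
      if "x \<in> carrier GK" "y \<in> carrier GK" for x y i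
      using that residue_section_mult[OF p_pos] K_self_similar K_closed by simp
    show "residue_section p x i = residue_section p x i'" if "[i = i'] (mod int p)" for x i i'
    proof -
      have "residue_letter p i = residue_letter p i'"
        using residue_letter_mem[OF p_pos] residue_letter_mod[OF p_pos, of i'] that cong_sym cong_trans
        by (intro residue_letter_eq) blast+
      then show ?thesis by (simp add: residue_section_def)
    qed
    show "rooted_aut p \<in> carrier GK" using rooted_K by simp
    show "[rotation p (rooted_aut p) = 1] (mod int p)" by (rule rooted_aut_facts(3)[OF p_pos])
    show "residue_section p (rooted_aut p) i = \<one>\<^bsub>GK\<^esub>" for i
      using rooted_aut_facts(4)[OF p_pos] by simp
    show "x = \<one>\<^bsub>GK\<^esub>" if x: "x \<in> carrier GK"
      and f: "\<And>n. fixes_level p (rotation p) (residue_section p) n x" for x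
    proof -
      have "x \<in> level_stabilizer p n" for n using fixes_level_iff f x by simp
      then have "x w = w" if "w \<in> words p" for w using that by (auto simp: level_stabilizer_def)
      then have "x = \<one>\<^bsub>Aut_tree p\<^esub>"
        using x K_closed by (intro Aut_tree_eqI) (auto simp: one_Aut_tree A.one_closed[unfolded one_Aut_tree])
      then show ?thesis by simp
    qed
  qed
qed

lemma KS_directed:
  assumes b: "b \<in> D j"
  shows "KS.directed j b"
  unfolding KS.directed_def
proof (intro conjI allI impI)
  show "b \<in> carrier GK" using family_K[OF b] by simp
  show "int p dvd rotation p b" using family_rotational(2)[OF b] by (simp add: cong_0_iff)
  show "residue_section p b j = b" by (rule family_section_self[OF b]) simp
  show "\<exists>k::int. residue_section p b i = rooted_aut p [^]\<^bsub>GK\<^esub> k" if "\<not> int p dvd i - j" for i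
    using family_section(1)[OF b that] A.int_pow_consistent[OF subgroup_K rooted_K] by simp
qed

sublocale KS: multi_EGS GK p "rotation p" "residue_section p" "rooted_aut p" D
proof
  show "carrier GK = generate GK (insert (rooted_aut p) (\<Union>j. D j))"
    using rooted_K family_K by (subst generate_GK) (auto simp: K_def[symmetric])
qed (rule KS_directed)

text \<open>Counted from \<open>j\<close>, the rotations of the sections are the entries of the defining vector.\<close>

lemma section_exponent:
  assumes b: "b \<in> D j" and e: "directed_along p (nat j) e b" and i: "i \<in> {1..<p}"
  shows "[rotation p (residue_section p b (j + int i)) = e i] (mod int p)"
proof -
  have j: "nat j \<in> alphabet p" using family[OF b] by blast
  then have jj: "1 \<le> j" "j \<le> int p" by (auto simp: alphabet_def)
  have ni: "\<not> int p dvd (j + int i) - j" using i zdvd_not_zless[of "int i" "int p"] by auto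
  have "path_exponent p (nat j) e (residue_letter p (j + int i)) = e i"
  proof (cases "j + int i \<le> int p")
    case True
    then have "residue_letter p (j + int i) = nat j + i"
      using jj by (intro residue_letter_eq) (auto simp: alphabet_def)
    then show ?thesis by (simp add: path_exponent_def)
  next
    case False
    then have "residue_letter p (j + int i) = nat j + i - p"
      using jj i by (intro residue_letter_eq) (auto simp: alphabet_def cong_iff_dvd_diff of_nat_diff)
    then show ?thesis using False jj i by (auto simp: path_exponent_def intro!: arg_cong[of _ _ e])
  qed
  then have "residue_section p b (j + int i) = rooted_aut p [^]\<^bsub>GK\<^esub> e i"
    using family_section(2)[OF b ni e] A.int_pow_consistent[OF subgroup_K rooted_K] by simp
  then show ?thesis using KS.rot_a_int_pow by simp
qed

end

lemma ex_pow_not_in_level_stabilizer: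
  assumes p: "Factorial_Ring.prime p" and j: "j \<in> alphabet p" and b: "directed_along p j e b"
    and i: "i \<in> {1..<p}" and one: "[e i = 1] (mod int p)"
    and sum: "int p dvd (\<Sum>k\<in>{0..<int p}. rotation p (residue_section p b k))"
  shows "\<exists>x\<in>generate (Aut_tree p) {rooted_aut p, b}.
    x [^]\<^bsub>Aut_tree p\<^esub> (p ^ m) \<notin> level_stabilizer p (2 * m + 1)"
proof -
  let ?D = "\<lambda>k. if k = int j then {b} else {}"
  interpret H: directed_families p ?D
    using p j b by unfold_locales (auto split: if_splits)
  have U: "(\<Union>k. ?D k) = {b}" by auto
  have bD: "b \<in> ?D (int j)" by simp
  have e: "directed_along p (nat (int j)) e b" using b by simp
  interpret Z: zero_sum_GGS H.GK p "rotation p" "residue_section p" "rooted_aut p" b "int j" "int i"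
  proof
    show "carrier H.GK = generate H.GK {rooted_aut p, b}" using H.KS.generated unfolding U by simp
    show "H.KS.directed (int j) b" by (rule H.KS_directed[OF bD])
    show "int p dvd H.KS.rot_sum b" unfolding H.KS.rot_sum_def by (rule sum)
    show "[rotation p (residue_section p b (int j + int i)) = 1] (mod int p)"
      using H.section_exponent[OF bD e i] one cong_trans by blast
  qed
  obtain x where x: "x \<in> H.K"
    "\<not> fixes_level p (rotation p) (residue_section p) (2 * m + 1) (x [^]\<^bsub>H.GK\<^esub> (p ^ m))"
    using Z.ex_pow_not_fixes_level[of m] by auto
  have "x [^]\<^bsub>H.GK\<^esub> (p ^ m) \<in> H.K" using H.KS.nat_pow_closed[of x "p ^ m"] x(1) by simp
  then have "x [^]\<^bsub>Aut_tree p\<^esub> (p ^ m) \<notin> level_stabilizer p (2 * m + 1)"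
    using H.fixes_level_iff x(2) H.A.nat_pow_consistent[of x "p ^ m" H.K]
    by (simp del: fixes_level.simps)
  moreover have "x \<in> generate (Aut_tree p) {rooted_aut p, b}" using x(1) unfolding H.K_def U by simp
  ultimately show ?thesis by blast
qed

section \<open>The exponents of the congruence quotients\<close>

theorem theorem1:
  fixes p n :: nat and K :: "(nat list \<Rightarrow> nat list) set"
  assumes "Factorial_Ring.prime p"
    and "is_multi_EGS_group p K"
    and "n \<ge> 1"
  shows "group_exponent (congruence_quotient p K n) =
    (if periodic_group ((Aut_tree p)\<lparr>carrier := K\<rparr>) then p ^ ((n + 1) div 2) else p ^ n)"
proof -
  note p = assms(1)
  have p0: "p > 0" using p prime_gt_0_nat by blast
  obtain E where sub: "\<And>j. j \<in> {1..p} \<Longrightarrow> submodule (E j) (residue_ring (int p)) (Fp_vectors p)"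
    and nontriv: "\<exists>j\<in>{1..p}. E j \<noteq> {\<zero>\<^bsub>Fp_vectors p\<^esub>}" and K: "K = multi_EGS_group p E"
    using assms(2) unfolding is_multi_EGS_group_def by blast
  define D where "D = (\<lambda>j::int. if nat j \<in> alphabet p then directed_family p (nat j) (E (nat j)) else {})"
  interpret M: directed_families p D
    using p by unfold_locales (auto simp: D_def directed_family_def split: if_splits)
  have "(\<Union>j. D j) = (\<Union>j\<in>{1..p}. directed_family p j (E j))"
  proof
    show "(\<Union>j. D j) \<subseteq> (\<Union>j\<in>{1..p}. directed_family p j (E j))"
      by (auto simp: D_def alphabet_def split: if_splits)
    have "directed_family p j (E j) \<subseteq> D (int j)" if "j \<in> {1..p}" for j
      using that by (simp add: D_def alphabet_def)
    then show "(\<Union>j\<in>{1..p}. directed_family p j (E j)) \<subseteq> (\<Union>j. D j)" by blast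
  qed
  then have MK: "M.K = K" unfolding M.K_def K multi_EGS_group_def by simp
  have St: "M.KS.St l x \<longleftrightarrow> x \<in> level_stabilizer p l" if "x \<in> K" for l x
    using M.fixes_level_iff that MK by simp
  have quot: "congruence_quotient p K n = M.GK Mod M.KS.level_kernel n"
  proof -
    have "level_stabilizer p n \<inter> K = M.KS.level_kernel n"
      unfolding M.KS.level_kernel_def using St MK by auto
    then show ?thesis unfolding congruence_quotient_def MK by simp
  qed
  show ?thesis
  proof (cases "\<exists>j. \<exists>b\<in>D j. \<not> int p dvd M.KS.rot_sum b")
    case True
    then obtain x where x: "x \<in> carrier M.GK" "\<And>l. \<not> M.KS.St (Suc l) (x [^]\<^bsub>M.GK\<^esub> (p ^ l))"
      using M.KS.ex_unbounded_order_if_nonzero_sum by blast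
    have "group_exponent (M.GK Mod M.KS.level_kernel (Suc (n - 1))) = p ^ Suc (n - 1)"
      using M.KS.group_exponent_level_quotient[OF M.KS.pow_fixes_level x(1) x(2)] by blast
    moreover have "\<not> periodic_group M.GK"
    proof
      assume "periodic_group M.GK"
      then obtain m :: nat where m: "0 < m" "x [^]\<^bsub>M.GK\<^esub> m = \<one>\<^bsub>M.GK\<^esub>"
        using x(1) unfolding periodic_group_def by blast
      \<comment> \<open>The order of \<open>x\<close> modulo the stabilizer of level \<open>m + 1\<close> is larger than the alleged order \<open>m\<close>.\<close>
      then have "p ^ Suc m dvd m"
        using M.KS.prime_power_dvd_if_fixes_level[OF x(1) _ x(2)] M.KS.St_one by metis
      then have "p ^ Suc m \<le> m" using m(1) dvd_imp_le by blast
      moreover have "Suc m < p ^ Suc m" using power_gt_expt[of p "Suc m"] prime_gt_1_nat[OF p] by simp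
      ultimately show False by simp
    qed
    ultimately show ?thesis using assms(3) quot MK by simp
  next
    case False
    interpret Z: zero_sum_multi_EGS M.GK p "rotation p" "residue_section p" "rooted_aut p" D
      by unfold_locales (use False in blast)
    have "periodic_group M.GK"
      unfolding periodic_group_def
    proof
      fix x assume "x \<in> carrier M.GK"
      then obtain k where "x [^]\<^bsub>M.GK\<^esub> (p ^ k) = \<one>\<^bsub>M.GK\<^esub>"
        using Z.periodic unfolding Z.p_torsion_def by blast
      moreover have "0 < p ^ k" using p0 by simp
      ultimately show "\<exists>m::nat. 0 < m \<and> x [^]\<^bsub>M.GK\<^esub> m = \<one>\<^bsub>M.GK\<^esub>" by blast
    qed
    moreover have "\<exists>x\<in>K. x [^]\<^bsub>Aut_tree p\<^esub> (p ^ m) \<notin> level_stabilizer p (2 * m + 1)" for m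
    proof -
      obtain j where j: "j \<in> {1..p}" "E j \<noteq> {\<zero>\<^bsub>Fp_vectors p\<^esub>}" using nontriv by blast
      interpret V: submodule "E j" "residue_ring (int p)" "Fp_vectors p" by (rule sub[OF j(1)])
      have zero: "\<zero>\<^bsub>Fp_vectors p\<^esub> \<in> E j" using V.one_closed by simp
      obtain e where e: "e \<in> E j" "e \<noteq> \<zero>\<^bsub>Fp_vectors p\<^esub>" using j(2) zero by blast
      have ecar: "e \<in> {1..<p} \<rightarrow>\<^sub>E {0..int p - 1}"
        using V.mem_carrier[OF e(1)] by (simp add: Fp_vectors_def residue_ring_def)
      obtain i where i: "i \<in> {1..<p}" "e i \<noteq> 0"
      proof -
        have "\<exists>i\<in>{1..<p}. e i \<noteq> 0"
        proof (rule ccontr)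
          assume "\<not> ?thesis"
          then have "e = \<zero>\<^bsub>Fp_vectors p\<^esub>"
            using ecar by (auto simp: Fp_vectors_def residue_ring_def fun_eq_iff PiE_def extensional_def)
          then show False using e(2) by simp
        qed
        then show thesis using that by blast
      qed
      have "0 \<le> e i" "e i < int p" using ecar i(1) by (auto dest!: PiE_mem)
      then have "\<not> int p dvd e i" using i(2) zdvd_not_zless[of "e i" "int p"] by simp
      then have "coprime (e i) (int p)"
        using p by (metis coprime_commute prime_imp_coprime prime_nat_int_transfer)
      then obtain r where r: "[e i * r = 1] (mod int p)" using cong_solve_coprime_int by blast
      \<comment> \<open>Rescaling the vector inside the subspace makes its \<open>i\<close>-th entry equal to \<open>1\<close>.\<close>
      define f where "f = (r mod int p) \<odot>\<^bsub>Fp_vectors p\<^esub> e"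
      have f: "f \<in> E j"
        unfolding f_def using p0 by (intro V.smult_closed e(1)) (simp add: residue_ring_def)
      have fi: "[f i = 1] (mod int p)"
        using r i(1) unfolding f_def by (simp add: Fp_vectors_def residue_ring_def cong_def mod_simps mult.commute)
      have ja: "j \<in> alphabet p" using j(1) by (simp add: alphabet_def)
      obtain b where b: "directed_along p j f b" using ex_directed_along[OF p0 ja] by blast
      have bD: "b \<in> D (int j)" using b f ja by (auto simp: D_def directed_family_def)
      have "int p dvd (\<Sum>k\<in>{0..<int p}. rotation p (residue_section p b k))"
        using Z.zero_sum[OF bD] unfolding M.KS.rot_sum_def .
      then obtain x where x: "x \<in> generate (Aut_tree p) {rooted_aut p, b}"
        "x [^]\<^bsub>Aut_tree p\<^esub> (p ^ m) \<notin> level_stabilizer p (2 * m + 1)"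
        using ex_pow_not_in_level_stabilizer[OF p ja b i(1) fi] by blast
      have "generate (Aut_tree p) {rooted_aut p, b} \<subseteq> K"
        unfolding MK[symmetric] using M.rooted_K M.family_K[OF bD]
        by (intro M.A.generate_subgroup_incl M.subgroup_K) auto
      then show ?thesis using x by blast
    qed
    moreover define m where "m = (n - 1) div 2"
    ultimately obtain x where x: "x \<in> K" "x [^]\<^bsub>Aut_tree p\<^esub> (p ^ m) \<notin> level_stabilizer p (2 * m + 1)"
      by blast
    have m: "2 * m + 1 \<le> n" "(n + 1) div 2 = Suc m" using assms(3) unfolding m_def by auto
    have xK: "x \<in> carrier M.GK" using x(1) MK by simp
    have pw: "x [^]\<^bsub>M.GK\<^esub> (p ^ m) = x [^]\<^bsub>Aut_tree p\<^esub> (p ^ m)"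
      by (rule M.A.nat_pow_consistent[symmetric])
    have "x [^]\<^bsub>M.GK\<^esub> (p ^ m) \<in> K" using M.KS.nat_pow_closed[OF xK] MK by simp
    then have "\<not> M.KS.St (2 * m + 1) (x [^]\<^bsub>M.GK\<^esub> (p ^ m))"
      using x(2) St unfolding pw by blast
    then have "\<not> M.KS.St n (x [^]\<^bsub>M.GK\<^esub> (p ^ m))" using M.KS.St_mono m(1) by blast
    then have "group_exponent (M.GK Mod M.KS.level_kernel n) = p ^ Suc m"
      using Z.pow_half_fixes_level(1)[where n = n] xK unfolding m(2)
      by (intro M.KS.group_exponent_level_quotient) auto
    then show ?thesis using \<open>periodic_group M.GK\<close> quot MK m(2) by simp
  qed
qed

end
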